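(* Let $\mathcal H$ be an orientably regular hypermap with hypermap subgroup $H$ and chirality index $\kappa$, and let $\mathcal H_\Delta$ and $\mathcal H^\Delta$ be the orientably regular hypermaps with hypermap subgroups $H\cap H^r$ and $HH^r$ respectively. Then the coverings $\mathcal H_\Delta\to\mathcal H$ and $\mathcal H\to\mathcal H^\Delta$ are both regular $\kappa$-sheeted coverings whose covering transformation groups are isomorphic to the chirality group $X(\mathcal H)$. Moreover the covering $\mathcal H_\Delta\to\mathcal H$ is smooth.
   Context: Let $\Delta=\langle r_0,r_1,r_2\mid r_0^2=r_1^2=r_2^2=1\rangle$ and let $\Delta^+$ be its index-$2$ subgroup of even-length words, generated by $\rho=r_1r_2$ and $\lambda=r_2r_0$. An (oriented) hypermap is a triple $\mathcal H=(D,R,L)$ with $D$ a finite set and $R,L$ permutations of $D$ such that $\langle R,L\rangle$ is transitive on $D$; its type is $(m,n,k)$ where $m,n,k$ are the orders of $RL$, $R$, $L$. It is orientably regular if its automorphism group (permutations of $D$ commuting with $R$ and $L$) acts regularly on $D$; then $\mathcal H\cong(\Delta^+/H,\rho,\lambda)$ (left multiplication on cosets) for a unique normal subgroup $H$ of finite index in $\Delta^+$ (the hypermap subgroup). For normal subgroups $K\leq H$ of $\Delta^+$ the hypermap with subgroup $K$ covers the one with subgroup $H$ via $xK\mapsto xH$; such a covering is regular when $K\trianglelefteq H$, with covering transformation group $H/K$ and number of sheets $|H:K|$, and it is smooth if both hypermaps have the same type. For $H\trianglelefteq\Delta^+$ put $H^r=r_2Hr_2$. The chirality group is $X(\mathcal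 H)=HH^r/H$ (isomorphic to $H/(H\cap H^r)$) and the chirality index is $\kappa=|X(\mathcal H)|$. *)

theory Defs
  imports "HOL-Algebra.Algebra" "HOL-Algebra.Left_Coset"
begin

section \<open>The group \<open>\<Delta>\<close> and its even subgroup\<close>

text \<open>
  \<open>\<Delta> = \<langle>r\<^sub>0, r\<^sub>1, r\<^sub>2 | r\<^sub>0\<^sup>2 = r\<^sub>1\<^sup>2 = r\<^sub>2\<^sup>2 = 1\<rangle>\<close>. The relators make every generator its own inverse, so
  words without formal inverses suffice: \<open>\<Delta>\<close> is the free monoid on three letters modulo the
  congruence generated by deleting a factor \<open>r\<^sub>i r\<^sub>i\<close>.
\<close>

datatype letter = L0 | L1 | L2

inductive cancel :: "letter list \<Rightarrow> letter list \<Rightarrow> bool" where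
  "cancel (u @ [a, a] @ v) (u @ v)"

quotient_type delta = "letter list" / "equivclp cancel"
  by (rule equivp_evquivclp)

lemma equivclp_cancel_map:
  assumes "equivclp cancel u v" and "\<And>x y. cancel x y \<Longrightarrow> equivclp cancel (f x) (f y)"
  shows "equivclp cancel (f u) (f v)"
  using assms(1)
proof (induction rule: equivclp_induct)
  case base
  show ?case by (rule equivclp_refl)
next
  case (step y z)
  then have "equivclp cancel (f y) (f z)"
    using assms(2) equivclp_sym by metis
  with step.IH show ?case by (rule equivclp_trans)
qed

lemma equivclp_cancel_append:
  assumes "equivclp cancel u u'" and "equivclp cancel v v'"
  shows "equivclp cancel (u @ v) (u' @ v')"
proof -
  have "equivclp cancel (u @ v) (u' @ v)"
  proof (rule equivclp_cancel_map[OF assms(1), where f = "\<lambda>w. w @ v"])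
    fix x y assume "cancel x y"
    then have "cancel (x @ v) (y @ v)"
      by (metis append.assoc cancel.simps)
    then show "equivclp cancel (x @ v) (y @ v)" by (rule r_into_equivclp)
  qed
  moreover have "equivclp cancel (u' @ v) (u' @ v')"
  proof (rule equivclp_cancel_map[OF assms(2), where f = "\<lambda>w. u' @ w"])
    fix x y assume "cancel x y"
    then have "cancel (u' @ x) (u' @ y)"
      by (metis append.assoc cancel.simps)
    then show "equivclp cancel (u' @ x) (u' @ y)" by (rule r_into_equivclp)
  qed
  ultimately show ?thesis by (rule equivclp_trans)
qed

lift_definition delta_mult :: "delta \<Rightarrow> delta \<Rightarrow> delta" is "(@)"
  by (rule equivclp_cancel_append)

lift_definition delta_one :: delta is "[]" .

lift_definition gen :: "letter \<Rightarrow> delta" is "\<lambda>a. [a]" .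

lift_definition even_word :: "delta \<Rightarrow> bool" is "\<lambda>w. even (length w)"
proof -
  fix u v assume "equivclp cancel u v"
  then show "even (length u) = even (length v)"
    by (induction rule: equivclp_induct) (auto elim!: cancel.cases)
qed

definition Delta :: "delta monoid" where
  "Delta = \<lparr>carrier = UNIV, monoid.mult = delta_mult, one = delta_one\<rparr>"

definition DeltaPlus :: "delta monoid" where
  "DeltaPlus = Delta\<lparr>carrier := {x. even_word x}\<rparr>"

definition rho :: delta where "rho = gen L1 \<otimes>\<^bsub>Delta\<^esub> gen L2"

definition lam :: delta where "lam = gen L2 \<otimes>\<^bsub>Delta\<^esub> gen L0"


section \<open>Oriented hypermaps\<close>

record 'd hypermap =
  darts :: "'d set"
  perm_R :: "'d \<Rightarrow> 'd"
  perm_L :: "'d \<Rightarrow> 'd"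

text \<open>
  As in \<^const>\<open>BijGroup\<close>, permutations of the dart set are extensional functions, and products are
  composed from right to left.
\<close>

definition hypermap :: "'d hypermap \<Rightarrow> bool" where
  "hypermap M \<longleftrightarrow>
     finite (darts M) \<and> darts M \<noteq> {} \<and>
     perm_R M \<in> carrier (BijGroup (darts M)) \<and> perm_L M \<in> carrier (BijGroup (darts M)) \<and>
     (\<forall>x\<in>darts M. \<forall>y\<in>darts M.
        \<exists>g\<in>generate (BijGroup (darts M)) {perm_R M, perm_L M}. g x = y)"

definition hypermap_type :: "'d hypermap \<Rightarrow> nat \<times> nat \<times> nat" where
  "hypermap_type M =
     (let S = BijGroup (darts M) in
      (group.ord S (perm_R M \<otimes>\<^bsub>S\<^esub> perm_L M), group.ord S (perm_R M), group.ord S (perm_L M)))"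

definition hypermap_automorphisms :: "'d hypermap \<Rightarrow> ('d \<Rightarrow> 'd) set" where
  "hypermap_automorphisms M =
     {a \<in> carrier (BijGroup (darts M)).
        \<forall>x\<in>darts M. a (perm_R M x) = perm_R M (a x) \<and> a (perm_L M x) = perm_L M (a x)}"

definition orientably_regular :: "'d hypermap \<Rightarrow> bool" where
  "orientably_regular M \<longleftrightarrow>
     hypermap M \<and>
     (\<forall>x\<in>darts M. \<forall>y\<in>darts M. \<exists>!a. a \<in> hypermap_automorphisms M \<and> a x = y)"

definition hypermap_iso :: "'d hypermap \<Rightarrow> 'e hypermap \<Rightarrow> ('d \<Rightarrow> 'e) \<Rightarrow> bool" where
  "hypermap_iso M N f \<longleftrightarrow>
     bij_betw f (darts M) (darts N) \<and>
     (\<forall>x\<in>darts M. f (perm_R M x) = perm_R N (f x) \<and> f (perm_L M x) = perm_L N (f x))"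

definition coset_hypermap :: "delta set \<Rightarrow> delta set hypermap" where
  "coset_hypermap H =
     \<lparr>darts = lcosets\<^bsub>DeltaPlus\<^esub> H,
      perm_R = (\<lambda>C\<in>lcosets\<^bsub>DeltaPlus\<^esub> H. rho <#\<^bsub>DeltaPlus\<^esub> C),
      perm_L = (\<lambda>C\<in>lcosets\<^bsub>DeltaPlus\<^esub> H. lam <#\<^bsub>DeltaPlus\<^esub> C)\<rparr>"

text \<open>The index of \<open>H\<close> is automatically finite when \<open>M\<close> is a hypermap.\<close>

definition hypermap_subgroup :: "'d hypermap \<Rightarrow> delta set \<Rightarrow> bool" where
  "hypermap_subgroup M H \<longleftrightarrow>
     H \<lhd> DeltaPlus \<and> (\<exists>f. hypermap_iso (coset_hypermap H) M f)"


section \<open>Coverings\<close>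

text \<open>
  \<open>f\<close> is the covering \<open>xK \<mapsto> xH\<close>, read through some identifications of \<open>M\<close> and \<open>N\<close> with the coset
  hypermaps of their hypermap subgroups.
\<close>

definition covering ::
  "'d hypermap \<Rightarrow> delta set \<Rightarrow> 'e hypermap \<Rightarrow> delta set \<Rightarrow> ('d \<Rightarrow> 'e) \<Rightarrow> bool" where
  "covering M K N H f \<longleftrightarrow>
     K \<lhd> DeltaPlus \<and> H \<lhd> DeltaPlus \<and> K \<subseteq> H \<and>
     (\<exists>a b. hypermap_iso (coset_hypermap K) M a \<and> hypermap_iso (coset_hypermap H) N b \<and>
        (\<forall>x\<in>carrier DeltaPlus. f (a (x <#\<^bsub>DeltaPlus\<^esub> K)) = b (x <#\<^bsub>DeltaPlus\<^esub> H)))"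

definition regular_covering ::
  "'d hypermap \<Rightarrow> delta set \<Rightarrow> 'e hypermap \<Rightarrow> delta set \<Rightarrow> ('d \<Rightarrow> 'e) \<Rightarrow> bool" where
  "regular_covering M K N H f \<longleftrightarrow>
     covering M K N H f \<and> K \<lhd> DeltaPlus\<lparr>carrier := H\<rparr>"

definition covering_group :: "delta set \<Rightarrow> delta set \<Rightarrow> delta set monoid" where
  "covering_group K H = DeltaPlus\<lparr>carrier := H\<rparr> Mod K"

definition covering_sheets :: "delta set \<Rightarrow> delta set \<Rightarrow> nat" where
  "covering_sheets K H = card (rcosets\<^bsub>DeltaPlus\<lparr>carrier := H\<rparr>\<^esub> K)"

text \<open>
  The geometric counterparts of the two preceding notions, for the covering map itself.
\<close>

definition deck_group :: "'d hypermap \<Rightarrow> ('d \<Rightarrow> 'e) \<Rightarrow> ('d \<Rightarrow> 'd) monoid" where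
  "deck_group M f =
     (BijGroup (darts M))\<lparr>carrier := {a \<in> hypermap_automorphisms M. \<forall>x\<in>darts M. f (a x) = f x}\<rparr>"

definition sheeted :: "'d hypermap \<Rightarrow> 'e hypermap \<Rightarrow> ('d \<Rightarrow> 'e) \<Rightarrow> nat \<Rightarrow> bool" where
  "sheeted M N f n \<longleftrightarrow> (\<forall>y\<in>darts N. card {x \<in> darts M. f x = y} = n)"

definition smooth_covering ::
  "'d hypermap \<Rightarrow> delta set \<Rightarrow> 'e hypermap \<Rightarrow> delta set \<Rightarrow> ('d \<Rightarrow> 'e) \<Rightarrow> bool" where
  "smooth_covering M K N H f \<longleftrightarrow>
     covering M K N H f \<and> hypermap_type M = hypermap_type N"


section \<open>Chirality\<close>

text \<open>\<open>mirror H\<close> is \<open>H\<^sup>r = r\<^sub>2 H r\<^sub>2\<close>.\<close>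

definition mirror :: "delta set \<Rightarrow> delta set" where
  "mirror H = (\<lambda>h. gen L2 \<otimes>\<^bsub>Delta\<^esub> h \<otimes>\<^bsub>Delta\<^esub> gen L2) ` H"

definition chirality_group :: "delta set \<Rightarrow> delta set monoid" where
  "chirality_group H = DeltaPlus\<lparr>carrier := H <#>\<^bsub>DeltaPlus\<^esub> mirror H\<rparr> Mod H"

definition chirality_index :: "delta set \<Rightarrow> nat" where
  "chirality_index H = order (chirality_group H)"


section \<open>Well-definedness\<close>

text \<open>
  \<open>\<Delta>\<^sup>+\<close> is a group generated by \<open>\<rho>\<close> and \<open>\<lambda>\<close>, every normal subgroup of finite index is the hypermap
  subgroup of an orientably regular hypermap, and if \<open>H\<close> is such a subgroup then so are \<open>H \<inter> H\<^sup>r\<close> and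
  \<open>HH\<^sup>r\<close>.
\<close>

lemma group_Delta: "group Delta"
proof (rule groupI)
  fix x y z assume "x \<in> carrier Delta"
  show "x \<otimes>\<^bsub>Delta\<^esub> y \<otimes>\<^bsub>Delta\<^esub> z = x \<otimes>\<^bsub>Delta\<^esub> (y \<otimes>\<^bsub>Delta\<^esub> z)"
    unfolding Delta_def by simp (transfer, simp)
next
  fix x 
  show "\<one>\<^bsub>Delta\<^esub> \<otimes>\<^bsub>Delta\<^esub> x = x"
    unfolding Delta_def by simp (transfer, simp)
next
  fix x 
  have "\<exists>v. equivclp cancel (v @ u) []" for u
  proof (induction u)
    case Nil
    show ?case by (rule exI[of _ "[]"]) simp
  next
    case (Cons a u)
    then obtain v where v: "equivclp cancel (v @ u) []" by blast
    have "cancel ((v @ [a]) @ a # u) (v @ u)" 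
      using cancel.intros[of v a u] by simp
    with v show ?case by (meson equivclp_trans r_into_equivclp)
  qed
  then have "\<exists>y. delta_mult y x = delta_one"
    by transfer blast
  then show "\<exists>y\<in>carrier Delta. y \<otimes>\<^bsub>Delta\<^esub> x = \<one>\<^bsub>Delta\<^esub>"
    unfolding Delta_def by simp
qed (simp_all add: Delta_def)

lemma gen_gen: "gen a \<otimes>\<^bsub>Delta\<^esub> gen a = \<one>\<^bsub>Delta\<^esub>"
  unfolding Delta_def apply simp apply transfer
  using cancel.intros[of "[]" _ "[]"] by (simp add: r_into_equivclp)

lemma even_one: "even_word \<one>\<^bsub>Delta\<^esub>"
  unfolding Delta_def apply simp by transfer simp

lemma even_mult: "even_word (x \<otimes>\<^bsub>Delta\<^esub> y) = (even_word x = even_word y)"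
  unfolding Delta_def apply simp apply transfer by simp

lemma even_gen: "\<not> even_word (gen a)"
  by transfer simp

lemma inv_gen: "inv\<^bsub>Delta\<^esub> gen a = gen a"
  by (rule group.inv_equality[OF group_Delta gen_gen]) (simp_all add: Delta_def)

lemma carrier_Delta: "x \<in> carrier Delta" by (simp add: Delta_def)

lemma subgroup_even: "subgroup {x. even_word x} Delta"
proof (rule group.subgroupI[OF group_Delta])
  show "{x. even_word x} \<noteq> {}" using even_one by blast
next
  fix x assume "x \<in> {x. even_word x}"
  have "inv\<^bsub>Delta\<^esub> x \<otimes>\<^bsub>Delta\<^esub> x = \<one>\<^bsub>Delta\<^esub>"
    by (rule group.l_inv[OF group_Delta carrier_Delta])
  then show "inv\<^bsub>Delta\<^esub> x \<in> {x. even_word x}"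
    using even_mult even_one \<open>x \<in> _\<close> by (metis mem_Collect_eq)
qed (auto simp: carrier_Delta even_mult)

lemma group_DeltaPlus: "group DeltaPlus"
  unfolding DeltaPlus_def by (rule subgroup.subgroup_is_group[OF subgroup_even group_Delta])

lemma generate_DeltaPlus: "generate DeltaPlus {rho, lam} = carrier DeltaPlus"
proof -
  interpret D: group Delta by (rule group_Delta)
  interpret P: group DeltaPlus by (rule group_DeltaPlus)
  have sub: "{rho, lam} \<subseteq> carrier DeltaPlus"
    by (auto simp: DeltaPlus_def rho_def lam_def even_mult even_gen)
  have m: "monoid.mult DeltaPlus = monoid.mult Delta" "one DeltaPlus = one Delta"
    by (auto simp: DeltaPlus_def)
  let ?g = "generate DeltaPlus {rho, lam}"
  have mul: "x \<otimes>\<^bsub>Delta\<^esub> y \<in> ?g" if "x \<in> ?g" "y \<in> ?g" for x y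
    using generate.eng[OF that] m by simp
  have inv: "inv\<^bsub>Delta\<^esub> x \<in> ?g" if "x \<in> ?g" for x
  proof -
    have "inv\<^bsub>DeltaPlus\<^esub> x = inv\<^bsub>Delta\<^esub> x"
      unfolding DeltaPlus_def
      using that P.generate_in_carrier[OF sub that]
      by (intro D.m_inv_consistent[OF subgroup_even]) (auto simp: DeltaPlus_def)
    then show ?thesis using P.generate_m_inv_closed[OF sub that] by simp
  qed
  have r: "rho \<in> ?g" and l: "lam \<in> ?g" by (auto intro: generate.incl)
  have one: "\<one>\<^bsub>Delta\<^esub> \<in> ?g" using generate.one[of DeltaPlus] m by simp
  have flip: "inv\<^bsub>Delta\<^esub> (gen a \<otimes>\<^bsub>Delta\<^esub> gen b) = gen b \<otimes>\<^bsub>Delta\<^esub> gen a" for a b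
    by (simp add: D.inv_mult_group carrier_Delta inv_gen)
  have r': "gen L2 \<otimes>\<^bsub>Delta\<^esub> gen L1 \<in> ?g" using inv[OF r] flip by (simp add: rho_def)
  have l': "gen L0 \<otimes>\<^bsub>Delta\<^esub> gen L2 \<in> ?g" using inv[OF l] flip by (simp add: lam_def)
  have "gen L1 \<otimes>\<^bsub>Delta\<^esub> gen L0 = rho \<otimes>\<^bsub>Delta\<^esub> lam"
    unfolding rho_def lam_def
    by (metis D.m_assoc D.r_one carrier_Delta gen_gen D.l_one)
  then have q: "gen L1 \<otimes>\<^bsub>Delta\<^esub> gen L0 \<in> ?g" using mul r l by simp
  have q': "gen L0 \<otimes>\<^bsub>Delta\<^esub> gen L1 \<in> ?g" using inv[OF q] flip by simp
  have two: "gen a \<otimes>\<^bsub>Delta\<^esub> gen b \<in> ?g" for a b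
    using r l r' l' q q' one gen_gen by (cases a; cases b) (auto simp: rho_def lam_def)
  have "even (length w) \<Longrightarrow> abs_delta w \<in> ?g" for w
  proof (induction w rule: induct_list012)
    case 1
    then show ?case using one by (simp add: Delta_def delta_one_def)
  next
    case (3 x y zs)
    have "abs_delta (x # y # zs) = gen x \<otimes>\<^bsub>Delta\<^esub> gen y \<otimes>\<^bsub>Delta\<^esub> abs_delta zs"
      by (simp add: Delta_def gen.abs_eq delta_mult.abs_eq)
    then show ?case using two mul 3 by auto
  qed simp
  then have "carrier DeltaPlus \<subseteq> ?g"
    unfolding DeltaPlus_def
    by simp (metis (mono_tags, lifting) DeltaPlus_def Quotient3_abs_rep Quotient3_delta even_word.abs_eq mem_Collect_eq subsetI)
  then show ?thesis using P.generate_incl[OF sub] by blast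
qed


definition lact :: "delta set \<Rightarrow> delta \<Rightarrow> delta set \<Rightarrow> delta set" where
  "lact N g = (\<lambda>C\<in>lcosets\<^bsub>DeltaPlus\<^esub> N. g <#\<^bsub>DeltaPlus\<^esub> C)"

lemma lcosets_iff: "C \<in> lcosets\<^bsub>G\<^esub> N \<longleftrightarrow> (\<exists>x\<in>carrier G. C = x <#\<^bsub>G\<^esub> N)"
  by (auto simp: LCOSETS_def)

lemma lact_hom:
  assumes "subgroup N DeltaPlus"
  shows "group_hom DeltaPlus (BijGroup (lcosets\<^bsub>DeltaPlus\<^esub> N)) (lact N)"
proof -
  interpret P: group DeltaPlus by (rule group_DeltaPlus)
  interpret N: subgroup N DeltaPlus by (rule assms)
  let ?D = "lcosets\<^bsub>DeltaPlus\<^esub> N"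
  have in_D: "lact N g C \<in> ?D" if "g \<in> carrier DeltaPlus" "C \<in> ?D" for g C
    using that unfolding lact_def
    by (auto simp: lcosets_iff P.lcos_m_assoc N.subset intro!: bexI[of _ "g \<otimes>\<^bsub>DeltaPlus\<^esub> _"])
  have sub: "C \<in> ?D \<Longrightarrow> C \<subseteq> carrier DeltaPlus" for C
    by (rule N.lcosets_carrier[OF group_DeltaPlus])
  have comp: "lact N g (lact N h C) = lact N (g \<otimes>\<^bsub>DeltaPlus\<^esub> h) C"
    if "g \<in> carrier DeltaPlus" "h \<in> carrier DeltaPlus" "C \<in> ?D" for g h C
    using that in_D[of h C] sub by (auto simp: lact_def P.lcos_m_assoc)
  have one: "lact N \<one>\<^bsub>DeltaPlus\<^esub> C = C" if "C \<in> ?D" for C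
    using that sub by (simp add: lact_def P.lcos_mult_one)
  have bij: "lact N g \<in> Bij ?D" if g: "g \<in> carrier DeltaPlus" for g
    unfolding Bij_def
  proof (intro IntI CollectI)
    show "lact N g \<in> extensional ?D" by (simp add: lact_def)
    show "bij_betw (lact N g) ?D ?D"
      by (rule bij_betw_byWitness[where f' = "lact N (inv\<^bsub>DeltaPlus\<^esub> g)"])
         (use g in \<open>auto simp: comp one in_D\<close>)
  qed
  show ?thesis
    unfolding group_hom_def group_hom_axioms_def hom_def
  proof (intro conjI CollectI ballI group_DeltaPlus group_BijGroup Pi_I)
    fix g h assume "g \<in> carrier DeltaPlus" "h \<in> carrier DeltaPlus"
    then show "lact N (g \<otimes>\<^bsub>DeltaPlus\<^esub> h) = lact N g \<otimes>\<^bsub>BijGroup ?D\<^esub> lact N h"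
      using comp bij P.m_closed
      by (intro extensionalityI[where A = ?D]) (auto simp: BijGroup_def compose_def lact_def[of N "g \<otimes>\<^bsub>DeltaPlus\<^esub> h"])
  qed (use bij in \<open>simp add: BijGroup_def\<close>)
qed

lemma rho_lam: "rho \<in> carrier DeltaPlus" "lam \<in> carrier DeltaPlus"
  by (auto simp: DeltaPlus_def rho_def lam_def even_mult even_gen)

lemma coset_hypermap_simps:
  "darts (coset_hypermap N) = lcosets\<^bsub>DeltaPlus\<^esub> N"
  "perm_R (coset_hypermap N) = lact N rho" "perm_L (coset_hypermap N) = lact N lam"
  by (auto simp: coset_hypermap_def lact_def)

lemma hypermap_coset_hypermap:
  assumes N: "subgroup N DeltaPlus" and fin: "finite (lcosets\<^bsub>DeltaPlus\<^esub> N)"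
  shows "hypermap (coset_hypermap N)"
proof -
  interpret P: group DeltaPlus by (rule group_DeltaPlus)
  interpret h: group_hom DeltaPlus "BijGroup (lcosets\<^bsub>DeltaPlus\<^esub> N)" "lact N"
    by (rule lact_hom[OF N])
  interpret N: subgroup N DeltaPlus by (rule N)
  let ?B = "BijGroup (lcosets\<^bsub>DeltaPlus\<^esub> N)"
  have gen: "generate ?B {lact N rho, lact N lam} = lact N ` carrier DeltaPlus"
    using h.generate_img[of "{rho, lam}"] rho_lam by (simp add: generate_DeltaPlus)
  have "\<exists>g\<in>generate ?B {lact N rho, lact N lam}. g C = C'"
    if C: "C \<in> lcosets\<^bsub>DeltaPlus\<^esub> N" and C': "C' \<in> lcosets\<^bsub>DeltaPlus\<^esub> N" for C C'
  proof -
    obtain x y where x: "x \<in> carrier DeltaPlus" "C = x <#\<^bsub>DeltaPlus\<^esub> N"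
      and y: "y \<in> carrier DeltaPlus" "C' = y <#\<^bsub>DeltaPlus\<^esub> N"
      using C C' lcosets_iff by metis
    have "lact N (y \<otimes>\<^bsub>DeltaPlus\<^esub> inv\<^bsub>DeltaPlus\<^esub> x) C = C'"
      using C x y P.lcos_m_assoc[OF N.subset] by (simp add: lact_def P.m_assoc)
    then show ?thesis unfolding gen using x y by blast
  qed
  moreover have "lcosets\<^bsub>DeltaPlus\<^esub> N \<noteq> {}" by (auto simp: LCOSETS_def)
  ultimately show ?thesis
    using fin h.hom_closed rho_lam by (simp add: hypermap_def coset_hypermap_simps)
qed

lemma orientably_regular_coset_hypermap:
  assumes N: "N \<lhd> DeltaPlus" and fin: "finite (lcosets\<^bsub>DeltaPlus\<^esub> N)"
  shows "orientably_regular (coset_hypermap N)"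
proof -
  interpret P: group DeltaPlus by (rule group_DeltaPlus)
  interpret N: normal N DeltaPlus by (rule N)
  interpret h: group_hom DeltaPlus "BijGroup (lcosets\<^bsub>DeltaPlus\<^esub> N)" "lact N"
    by (rule lact_hom[OF N.subgroup_axioms])
  let ?D = "lcosets\<^bsub>DeltaPlus\<^esub> N"
  let ?B = "BijGroup ?D"
  let ?M = "coset_hypermap N"
  define ract where "ract c = (\<lambda>C\<in>?D. C #>\<^bsub>DeltaPlus\<^esub> c)" for c
  have ract: "ract c (x <#\<^bsub>DeltaPlus\<^esub> N) = (x \<otimes>\<^bsub>DeltaPlus\<^esub> c) <#\<^bsub>DeltaPlus\<^esub> N"
    if "x \<in> carrier DeltaPlus" "c \<in> carrier DeltaPlus" for x c
    using that N.coset_eq by (auto simp: ract_def lcosets_iff P.coset_assoc[symmetric] N.subset P.lcos_m_assoc)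
  have lact: "lact N g (x <#\<^bsub>DeltaPlus\<^esub> N) = (g \<otimes>\<^bsub>DeltaPlus\<^esub> x) <#\<^bsub>DeltaPlus\<^esub> N"
    if "x \<in> carrier DeltaPlus" "g \<in> carrier DeltaPlus" for x g
    using that by (auto simp: lact_def lcosets_iff N.subset P.lcos_m_assoc)
  have ract_aut: "ract c \<in> hypermap_automorphisms ?M" if c: "c \<in> carrier DeltaPlus" for c
  proof -
    have "bij_betw (ract c) ?D ?D"
      by (rule bij_betw_byWitness[where f' = "ract (inv\<^bsub>DeltaPlus\<^esub> c)"])
         (use c in \<open>force simp: lcosets_iff ract P.m_assoc\<close>)+
    then have "ract c \<in> carrier ?B"
      by (simp add: BijGroup_def Bij_def ract_def)
    then show ?thesis
      using c rho_lam by (auto simp: hypermap_automorphisms_def coset_hypermap_simps lcosets_iff ract lact P.m_assoc)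
  qed
  have comm: "a (lact N g C) = lact N g (a C)"
    if a: "a \<in> hypermap_automorphisms ?M" and g: "g \<in> carrier DeltaPlus" and C: "C \<in> ?D" for a g C
  proof -
    have aD: "a C \<in> ?D" if "C \<in> ?D" for C
      using a that by (auto simp: hypermap_automorphisms_def coset_hypermap_simps BijGroup_def Bij_def bij_betw_def)
    have lD: "lact N g C \<in> ?D" if "C \<in> ?D" "g \<in> carrier DeltaPlus" for C g
      using h.hom_closed[OF that(2)] that by (auto simp: BijGroup_def Bij_def bij_betw_def)
    have mul: "lact N (x \<otimes>\<^bsub>DeltaPlus\<^esub> y) C = lact N x (lact N y C)"
      if "C \<in> ?D" "x \<in> carrier DeltaPlus" "y \<in> carrier DeltaPlus" for C x y
      using that h.hom_mult[OF that(2,3)] h.hom_closed by (simp add: BijGroup_def compose_def)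
    have one: "lact N \<one>\<^bsub>DeltaPlus\<^esub> C = C" if "C \<in> ?D" for C
      using that h.hom_one by (simp add: BijGroup_def)
    have gen: "g \<in> generate DeltaPlus {rho, lam}" using g generate_DeltaPlus by simp
    have base: "a (lact N g C) = lact N g (a C)" if "g \<in> {rho, lam}" "C \<in> ?D" for g C
      using a that by (auto simp: hypermap_automorphisms_def coset_hypermap_simps)
    from gen C show ?thesis
    proof (induction arbitrary: C rule: generate.induct)
      case one
      then show ?case using aD \<open>\<And>C. C \<in> ?D \<Longrightarrow> lact N \<one>\<^bsub>DeltaPlus\<^esub> C = C\<close> by simp
    next
      case (incl h)
      then show ?case by (rule base)
    next
      case (inv h)
      then have hP: "h \<in> carrier DeltaPlus" using rho_lam by auto
      let ?i = "inv\<^bsub>DeltaPlus\<^esub> h"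
      have iC: "lact N ?i C \<in> ?D" using lD[OF inv(2) P.inv_closed[OF hP]] .
      have "lact N h (a (lact N ?i C)) = a (lact N h (lact N ?i C))"
        using base[OF inv(1) iC] by simp
      also have "\<dots> = a C" using mul[OF inv(2) hP P.inv_closed[OF hP]] one[OF inv(2)] hP by simp
      finally have "lact N ?i (lact N h (a (lact N ?i C))) = lact N ?i (a C)" by simp
      then show ?case using mul[OF aD[OF iC] P.inv_closed[OF hP] hP] hP one[OF aD[OF iC]] P.l_inv[OF hP] by metis
    next
      case (eng h1 h2)
      have "h1 \<in> carrier DeltaPlus" "h2 \<in> carrier DeltaPlus"
        using eng(1,2) generate_DeltaPlus by auto
      then show ?case using eng mul lD aD by simp
    qed
  qed
  have "\<exists>!a. a \<in> hypermap_automorphisms ?M \<and> a C = C'" if C: "C \<in> ?D" and C': "C' \<in> ?D" for C C'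
  proof -
    obtain x y where x: "x \<in> carrier DeltaPlus" "C = x <#\<^bsub>DeltaPlus\<^esub> N"
      and y: "y \<in> carrier DeltaPlus" "C' = y <#\<^bsub>DeltaPlus\<^esub> N"
      using C C' lcosets_iff by metis
    show ?thesis
    proof (rule ex_ex1I)
      show "\<exists>a. a \<in> hypermap_automorphisms ?M \<and> a C = C'"
        by (rule exI[of _ "ract (inv\<^bsub>DeltaPlus\<^esub> x \<otimes>\<^bsub>DeltaPlus\<^esub> y)"])
           (use x y in \<open>simp add: ract_aut ract P.m_assoc[symmetric]\<close>)
    next
      fix a b assume a: "a \<in> hypermap_automorphisms ?M \<and> a C = C'" and b: "b \<in> hypermap_automorphisms ?M \<and> b C = C'"
      show "a = b"
      proof (rule extensionalityI[where A = ?D])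
        show "a \<in> extensional ?D" "b \<in> extensional ?D"
          using a b by (auto simp: hypermap_automorphisms_def coset_hypermap_simps BijGroup_def Bij_def)
        fix E assume "E \<in> ?D"
        then obtain z where z: "z \<in> carrier DeltaPlus" "E = z <#\<^bsub>DeltaPlus\<^esub> N" using lcosets_iff by metis
        have E: "E = lact N (z \<otimes>\<^bsub>DeltaPlus\<^esub> inv\<^bsub>DeltaPlus\<^esub> x) C"
          using x z lact[OF x(1), of "z \<otimes>\<^bsub>DeltaPlus\<^esub> inv\<^bsub>DeltaPlus\<^esub> x"]
          by (simp add: P.m_assoc del: h.hom_mult h.hom_inv)
        have "z \<otimes>\<^bsub>DeltaPlus\<^esub> inv\<^bsub>DeltaPlus\<^esub> x \<in> carrier DeltaPlus" using x z by simp
        with a b C show "a E = b E" unfolding E by (metis comm)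
      qed
    qed
  qed
  then show ?thesis
    using hypermap_coset_hypermap[OF N.subgroup_axioms fin]
    by (auto simp: orientably_regular_def coset_hypermap_simps)
qed

lemma hypermap_subgroup_coset_hypermap:
  assumes N: "N \<lhd> DeltaPlus"
  shows "hypermap_subgroup (coset_hypermap N) N"
  unfolding hypermap_subgroup_def hypermap_iso_def using N 
  by (auto intro!: exI[of _ "\<lambda>x. x"] simp: bij_betw_def)

lemma mirror_normal:
  assumes H: "H \<lhd> DeltaPlus"
  shows "mirror H \<lhd> DeltaPlus"
proof -
  interpret D: group Delta by (rule group_Delta)
  interpret P: group DeltaPlus by (rule group_DeltaPlus)
  interpret H: normal H DeltaPlus by (rule H)
  let ?c = "\<lambda>x. gen L2 \<otimes>\<^bsub>Delta\<^esub> x \<otimes>\<^bsub>Delta\<^esub> gen L2"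
  have cc: "?c (?c x) = x" for x
  proof -
    have "?c (?c x) = (gen L2 \<otimes>\<^bsub>Delta\<^esub> gen L2) \<otimes>\<^bsub>Delta\<^esub> x \<otimes>\<^bsub>Delta\<^esub> (gen L2 \<otimes>\<^bsub>Delta\<^esub> gen L2)"
      by (simp only: D.m_assoc carrier_Delta D.m_closed)
    then show ?thesis by (simp add: gen_gen carrier_Delta)
  qed
  have in_P: "x \<in> carrier DeltaPlus \<longleftrightarrow> even_word x" for x by (simp add: DeltaPlus_def)
  have m: "monoid.mult DeltaPlus = monoid.mult Delta" by (simp add: DeltaPlus_def)
  have c_in: "?c x \<in> carrier DeltaPlus" if "x \<in> carrier DeltaPlus" for x
    using that by (simp add: in_P even_mult even_gen)
  have c_mult0: "?c (x \<otimes>\<^bsub>Delta\<^esub> y) = ?c x \<otimes>\<^bsub>Delta\<^esub> ?c y" for x y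
  proof -
    have "?c x \<otimes>\<^bsub>Delta\<^esub> ?c y = gen L2 \<otimes>\<^bsub>Delta\<^esub> x \<otimes>\<^bsub>Delta\<^esub> (gen L2 \<otimes>\<^bsub>Delta\<^esub> gen L2) \<otimes>\<^bsub>Delta\<^esub> y \<otimes>\<^bsub>Delta\<^esub> gen L2"
      by (simp only: D.m_assoc carrier_Delta D.m_closed)
    also have "\<dots> = ?c (x \<otimes>\<^bsub>Delta\<^esub> y)"
      by (simp add: gen_gen carrier_Delta D.m_assoc)
    finally show ?thesis ..
  qed
  have c_mult: "?c (x \<otimes>\<^bsub>DeltaPlus\<^esub> y) = ?c x \<otimes>\<^bsub>DeltaPlus\<^esub> ?c y" for x y
    unfolding m by (rule c_mult0)
  interpret c: group_hom DeltaPlus DeltaPlus ?c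
    by unfold_locales (auto simp: hom_def c_in c_mult)
  have "subgroup (?c ` H) DeltaPlus"
    by (rule c.subgroup_img_is_subgroup[OF H.subgroup_axioms])
  moreover have "x \<otimes>\<^bsub>DeltaPlus\<^esub> h \<otimes>\<^bsub>DeltaPlus\<^esub> inv\<^bsub>DeltaPlus\<^esub> x \<in> ?c ` H"
    if x: "x \<in> carrier DeltaPlus" and h: "h \<in> ?c ` H" for x h
  proof -
    obtain k where k: "k \<in> H" "h = ?c k" using h by blast
    have "?c x \<otimes>\<^bsub>DeltaPlus\<^esub> k \<otimes>\<^bsub>DeltaPlus\<^esub> inv\<^bsub>DeltaPlus\<^esub> (?c x) \<in> H"
      using H.inv_op_closed2[OF c_in[OF x] k(1)] .
    then have "?c (?c x \<otimes>\<^bsub>DeltaPlus\<^esub> k \<otimes>\<^bsub>DeltaPlus\<^esub> inv\<^bsub>DeltaPlus\<^esub> (?c x)) \<in> ?c ` H" by (rule imageI)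
    moreover have "inv\<^bsub>DeltaPlus\<^esub> (?c x) = ?c (inv\<^bsub>DeltaPlus\<^esub> x)"
      using c.hom_inv[OF x] by simp
    ultimately show ?thesis unfolding k(2) by (simp only: c_mult cc)
  qed
  ultimately show ?thesis unfolding mirror_def P.normal_inv_iff by blast
qed

lemma finite_lcosets_superset:
  assumes "group G" and "subgroup H G" "subgroup K G" "H \<subseteq> K" and "finite (lcosets\<^bsub>G\<^esub> H)"
  shows "finite (lcosets\<^bsub>G\<^esub> K)"
proof -
  interpret G: group G by fact
  have "H <#>\<^bsub>G\<^esub> K = K"
  proof
    show "H <#>\<^bsub>G\<^esub> K \<subseteq> K"
      using assms(4) subgroup.m_closed[OF assms(3)] by (auto simp: set_mult_def)
    show "K \<subseteq> H <#>\<^bsub>G\<^esub> K"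
    proof
      fix k assume "k \<in> K"
      then have "k = \<one>\<^bsub>G\<^esub> \<otimes>\<^bsub>G\<^esub> k" using subgroup.subset[OF assms(3)] by auto
      with \<open>k \<in> K\<close> subgroup.one_closed[OF assms(2)] show "k \<in> H <#>\<^bsub>G\<^esub> K"
        unfolding set_mult_def by blast
    qed
  qed
  then have "x <#\<^bsub>G\<^esub> K = (x <#\<^bsub>G\<^esub> H) <#>\<^bsub>G\<^esub> K" if "x \<in> carrier G" for x
    using that G.set_mult_assoc[of "{x}" H K] subgroup.subset[OF assms(2)] subgroup.subset[OF assms(3)]
    by (simp add: l_coset_eq_set_mult)
  then have "lcosets\<^bsub>G\<^esub> K \<subseteq> (\<lambda>C. C <#>\<^bsub>G\<^esub> K) ` (lcosets\<^bsub>G\<^esub> H)"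
    by (auto simp: LCOSETS_def)
  with assms(5) show ?thesis by (meson finite_imageI finite_subset)
qed

lemma finite_lcosets_Int:
  assumes "finite (lcosets\<^bsub>G\<^esub> H)" "finite (lcosets\<^bsub>G\<^esub> K)" and "group G" "subgroup H G" "subgroup K G"
  shows "finite (lcosets\<^bsub>G\<^esub> (H \<inter> K))"
proof -
  interpret G: group G by fact
  have "x <#\<^bsub>G\<^esub> (H \<inter> K) = (x <#\<^bsub>G\<^esub> H) \<inter> (x <#\<^bsub>G\<^esub> K)" if "x \<in> carrier G" for x
  proof -
    have "inj_on (monoid.mult G x) (carrier G)" using that by (rule G.inj_on_cmult)
    then show ?thesis
      using inj_on_image_Int[of "monoid.mult G x" "carrier G" H K] subgroup.subset[OF assms(4)]
        subgroup.subset[OF assms(5)]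
      by (simp add: l_coset_def UNION_singleton_eq_range)
  qed
  then have "lcosets\<^bsub>G\<^esub> (H \<inter> K) \<subseteq> (\<lambda>(A, B). A \<inter> B) ` ((lcosets\<^bsub>G\<^esub> H) \<times> (lcosets\<^bsub>G\<^esub> K))"
    by (auto simp: LCOSETS_def)
  with assms(1,2) show ?thesis by (meson finite_SigmaI finite_imageI finite_subset)
qed

lemma finite_lcosets_mirror:
  assumes "H \<lhd> DeltaPlus" "finite (lcosets\<^bsub>DeltaPlus\<^esub> H)"
  shows "finite (lcosets\<^bsub>DeltaPlus\<^esub> mirror H)"
proof -
  interpret D: group Delta by (rule group_Delta)
  let ?c = "\<lambda>x. gen L2 \<otimes>\<^bsub>Delta\<^esub> x \<otimes>\<^bsub>Delta\<^esub> gen L2"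
  have cc: "?c (?c x) = x" for x
  proof -
    have "?c (?c x) = (gen L2 \<otimes>\<^bsub>Delta\<^esub> gen L2) \<otimes>\<^bsub>Delta\<^esub> x \<otimes>\<^bsub>Delta\<^esub> (gen L2 \<otimes>\<^bsub>Delta\<^esub> gen L2)"
      by (simp only: D.m_assoc carrier_Delta D.m_closed)
    then show ?thesis by (simp add: gen_gen carrier_Delta)
  qed
  have c_mult: "?c (x \<otimes>\<^bsub>Delta\<^esub> y) = ?c x \<otimes>\<^bsub>Delta\<^esub> ?c y" for x y
  proof -
    have "?c x \<otimes>\<^bsub>Delta\<^esub> ?c y = gen L2 \<otimes>\<^bsub>Delta\<^esub> x \<otimes>\<^bsub>Delta\<^esub> (gen L2 \<otimes>\<^bsub>Delta\<^esub> gen L2) \<otimes>\<^bsub>Delta\<^esub> y \<otimes>\<^bsub>Delta\<^esub> gen L2"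
      by (simp only: D.m_assoc carrier_Delta D.m_closed)
    also have "\<dots> = ?c (x \<otimes>\<^bsub>Delta\<^esub> y)"
      by (simp add: gen_gen carrier_Delta D.m_assoc)
    finally show ?thesis ..
  qed

  have "x <#\<^bsub>DeltaPlus\<^esub> mirror H = ?c ` (?c x <#\<^bsub>DeltaPlus\<^esub> H)" for x
  proof -
    have "?c ` (?c x <#\<^bsub>DeltaPlus\<^esub> H) = (\<lambda>h. ?c (?c x \<otimes>\<^bsub>Delta\<^esub> h)) ` H"
      by (simp add: l_coset_def DeltaPlus_def image_UN UNION_singleton_eq_range image_image)
    also have "\<dots> = (\<lambda>h. x \<otimes>\<^bsub>Delta\<^esub> ?c h) ` H" by (simp only: c_mult[of "?c x"] cc)
    also have "\<dots> = x <#\<^bsub>DeltaPlus\<^esub> mirror H"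
      by (simp add: l_coset_def DeltaPlus_def mirror_def UNION_singleton_eq_range image_image)
    finally show ?thesis ..
  qed
  moreover have "?c x \<in> carrier DeltaPlus" if "x \<in> carrier DeltaPlus" for x
    using that by (simp add: DeltaPlus_def even_mult even_gen)
  ultimately have "lcosets\<^bsub>DeltaPlus\<^esub> mirror H \<subseteq> (\<lambda>C. ?c ` C) ` (lcosets\<^bsub>DeltaPlus\<^esub> H)"
    unfolding LCOSETS_def by blast
  with assms(2) show ?thesis by (meson finite_imageI finite_subset)
qed


lemma core_product_hypermaps:
  assumes "orientably_regular M" and "hypermap_subgroup M H"
    and "K = H \<inter> mirror H \<or> K = H <#>\<^bsub>DeltaPlus\<^esub> mirror H"
  shows "orientably_regular (coset_hypermap K)" "hypermap_subgroup (coset_hypermap K) K"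
proof -
  interpret P: group DeltaPlus by (rule group_DeltaPlus)
  have H: "H \<lhd> DeltaPlus" using assms(2) by (simp add: hypermap_subgroup_def)
  then interpret H: normal H DeltaPlus .
  note m = mirror_normal[OF H]
  interpret m: normal "mirror H" DeltaPlus by (rule m)
  have fin: "finite (lcosets\<^bsub>DeltaPlus\<^esub> H)"
    using assms(1,2) bij_betw_finite
    by (auto simp: hypermap_subgroup_def hypermap_iso_def orientably_regular_def hypermap_def
        coset_hypermap_simps)
  have I: "H \<inter> mirror H \<lhd> DeltaPlus" by (rule P.normal_subgroup_intersect[OF H m])
  have J: "H <#>\<^bsub>DeltaPlus\<^esub> mirror H \<lhd> DeltaPlus" by (rule P.normal_subgroup_set_mult_closed[OF H m])
  have fin_I: "finite (lcosets\<^bsub>DeltaPlus\<^esub> (H \<inter> mirror H))"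
    by (rule finite_lcosets_Int[OF fin finite_lcosets_mirror[OF H fin] group_DeltaPlus
          H.subgroup_axioms m.subgroup_axioms])
  have "H \<subseteq> H <#>\<^bsub>DeltaPlus\<^esub> mirror H"
  proof
    fix h assume "h \<in> H"
    moreover from this have "h = h \<otimes>\<^bsub>DeltaPlus\<^esub> \<one>\<^bsub>DeltaPlus\<^esub>" using H.subset by auto
    ultimately show "h \<in> H <#>\<^bsub>DeltaPlus\<^esub> mirror H" unfolding set_mult_def using m.one_closed by blast
  qed
  then have fin_J: "finite (lcosets\<^bsub>DeltaPlus\<^esub> (H <#>\<^bsub>DeltaPlus\<^esub> mirror H))"
    by (rule finite_lcosets_superset[OF group_DeltaPlus H.subgroup_axioms
          normal_imp_subgroup[OF J] _ fin])
  have "K \<lhd> DeltaPlus" "finite (lcosets\<^bsub>DeltaPlus\<^esub> K)"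
    using assms(3) I J fin_I fin_J by auto
  then show "orientably_regular (coset_hypermap K)" "hypermap_subgroup (coset_hypermap K) K"
    by (auto intro: orientably_regular_coset_hypermap hypermap_subgroup_coset_hypermap)
qed

end

theory Submission
  imports Defs
begin

text \<open>
  The covering with subgroups \<open>K \<le> H\<close> has deck group \<open>H/K\<close>, acting by right translations, and its
  fibres are the cosets of \<open>K\<close> in a coset of \<open>H\<close>. For the upper covering \<open>H/K\<close> becomes \<open>HH\<^sup>r/H\<close>, the
  chirality group itself. For the lower one it is \<open>H/(H \<inter> H\<^sup>r)\<close>; conjugation by \<open>r\<^sub>2\<close> maps \<open>H\<close> onto
  \<open>H\<^sup>r\<close>, so the kernel of \<open>H \<rightarrow> HH\<^sup>r/H\<close>, \<open>h \<mapsto> H h\<^sup>r\<close>, is \<open>H \<inter> H\<^sup>r\<close> and the map is onto.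
  The lower covering is smooth because conjugation by \<open>r\<^sub>2\<close> sends each of \<open>\<rho>\<close>, \<open>\<lambda>\<close>, \<open>\<rho>\<lambda>\<close> to a
  conjugate of its inverse, so that the same powers of it lie in \<open>H\<close> and in \<open>H\<^sup>r\<close>.
\<close>

section \<open>Hypermaps identified with coset hypermaps\<close>

interpretation P: group DeltaPlus by (rule group_DeltaPlus)

section \<open>Membership criteria for cosets, and pointwise reasoning about permutations\<close>

lemma (in subgroup) l_coset_eq_iff:
  assumes "group G" "x \<in> carrier G" "y \<in> carrier G"
  shows "x <# H = y <# H \<longleftrightarrow> inv x \<otimes> y \<in> H"
proof -
  interpret group G by fact
  show ?thesis
  proof
    assume "x <# H = y <# H"
    then have "y \<in> x <# H" using lcos_self[OF assms(3) subgroup_axioms] by simp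
    then show "inv x \<otimes> y \<in> H" by (rule lcos_module_imp[OF assms(1,2)])
  next
    assume *: "inv x \<otimes> y \<in> H"
    have "y <# H = x <# ((inv x \<otimes> y) <# H)"
      using assms by (simp add: lcos_m_assoc subset m_assoc[symmetric])
    also have "(inv x \<otimes> y) <# H = H"
      using * assms by (intro coset_join3) (auto simp: subgroup_axioms)
    finally show "x <# H = y <# H" ..
  qed
qed

lemma (in normal) conj_mem_iff:
  assumes "x \<in> carrier G" "u \<in> carrier G"
  shows "inv x \<otimes> u \<otimes> x \<in> H \<longleftrightarrow> u \<in> H"
proof -
  have "u = x \<otimes> (inv x \<otimes> u \<otimes> x) \<otimes> inv x"
    using assms by (simp add: m_assoc) (simp add: m_assoc[symmetric])
  then show ?thesis using inv_op_closed1 inv_op_closed2 assms(1) by metis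
qed

lemma BijGroup_mult_apply:
  assumes "f \<in> carrier (BijGroup S)" "g \<in> carrier (BijGroup S)" "x \<in> S"
  shows "(f \<otimes>\<^bsub>BijGroup S\<^esub> g) x = f (g x)"
  using assms by (simp add: BijGroup_def compose_def)

lemma BijGroup_one_apply: "x \<in> S \<Longrightarrow> \<one>\<^bsub>BijGroup S\<^esub> x = x"
  by (simp add: BijGroup_def)

lemma BijGroup_eqI:
  assumes "f \<in> carrier (BijGroup S)" "g \<in> carrier (BijGroup S)" "\<And>x. x \<in> S \<Longrightarrow> f x = g x"
  shows "f = g"
  using assms by (intro extensionalityI[where A = S]) (auto simp: BijGroup_def Bij_def)

text \<open>The identification of a hypermap with the coset hypermap of \<open>K\<close> is not
  canonical, so one choice \<open>a\<close> is fixed here. Darts can then be handled through group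
  elements.\<close>

locale identified_hypermap =
  K: normal K DeltaPlus for K :: "delta set" +
  fixes M :: "'d hypermap" and a :: "delta set \<Rightarrow> 'd"
  assumes iso: "hypermap_iso (coset_hypermap K) M a"
begin

definition dart :: "delta \<Rightarrow> 'd" where
  "dart x = a (x <#\<^bsub>DeltaPlus\<^esub> K)"

lemma inj_on_a: "inj_on a (lcosets\<^bsub>DeltaPlus\<^esub> K)"
  using iso by (simp add: hypermap_iso_def coset_hypermap_simps bij_betw_def)

lemma darts_eq: "darts M = dart ` carrier DeltaPlus"
proof -
  have "darts M = a ` (lcosets\<^bsub>DeltaPlus\<^esub> K)"
    using iso by (simp add: hypermap_iso_def coset_hypermap_simps bij_betw_def)
  then show ?thesis by (auto simp: dart_def LCOSETS_def)
qed

lemma dart_in_darts: "x \<in> carrier DeltaPlus \<Longrightarrow> dart x \<in> darts M"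
  by (simp add: darts_eq)

lemma dart_eq_iff:
  assumes "x \<in> carrier DeltaPlus" "y \<in> carrier DeltaPlus"
  shows "dart x = dart y \<longleftrightarrow> inv\<^bsub>DeltaPlus\<^esub> x \<otimes>\<^bsub>DeltaPlus\<^esub> y \<in> K"
proof -
  have "dart x = dart y \<longleftrightarrow> x <#\<^bsub>DeltaPlus\<^esub> K = y <#\<^bsub>DeltaPlus\<^esub> K"
    unfolding dart_def using assms by (intro inj_on_eq_iff[OF inj_on_a]) (auto simp: lcosets_iff)
  then show ?thesis using K.l_coset_eq_iff[OF P.is_group assms] by simp
qed

lemma dart_mult_left_cong:
  assumes "dart x = dart y"
    and "x \<in> carrier DeltaPlus" "y \<in> carrier DeltaPlus" "g \<in> carrier DeltaPlus"
  shows "dart (g \<otimes>\<^bsub>DeltaPlus\<^esub> x) = dart (g \<otimes>\<^bsub>DeltaPlus\<^esub> y)"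
  using assms unfolding dart_def
  by (simp add: P.lcos_m_assoc[OF K.subset, symmetric] dart_eq_iff[unfolded dart_def]
      K.l_coset_eq_iff[OF P.is_group, symmetric])

text \<open>Left multiplication descends to left cosets of any subgroup; right multiplication needs
  normality. Passing from \<open>x\<close>, \<open>y\<close> to \<open>x c\<close>,
  \<open>y c\<close> conjugates the quotient x^{-1} y by \<open>c\<close>, and \<open>K\<close> is
  stable under conjugation.\<close>

lemma dart_mult_right_eq_iff:
  assumes "x \<in> carrier DeltaPlus" "y \<in> carrier DeltaPlus" "c \<in> carrier DeltaPlus"
  shows "dart (x \<otimes>\<^bsub>DeltaPlus\<^esub> c) = dart (y \<otimes>\<^bsub>DeltaPlus\<^esub> c) \<longleftrightarrow> dart x = dart y"
proof -
  let ?u = "inv\<^bsub>DeltaPlus\<^esub> x \<otimes>\<^bsub>DeltaPlus\<^esub> y"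
  have eq: "inv\<^bsub>DeltaPlus\<^esub> (x \<otimes>\<^bsub>DeltaPlus\<^esub> c) \<otimes>\<^bsub>DeltaPlus\<^esub> (y \<otimes>\<^bsub>DeltaPlus\<^esub> c)
      = inv\<^bsub>DeltaPlus\<^esub> c \<otimes>\<^bsub>DeltaPlus\<^esub> ?u \<otimes>\<^bsub>DeltaPlus\<^esub> c"
    using assms by (simp add: P.inv_mult_group P.m_assoc)
  show ?thesis using assms by (simp add: dart_eq_iff eq K.conj_mem_iff)
qed

lemma perm_dart:
  assumes "x \<in> carrier DeltaPlus"
  shows "perm_R M (dart x) = dart (rho \<otimes>\<^bsub>DeltaPlus\<^esub> x)"
    and "perm_L M (dart x) = dart (lam \<otimes>\<^bsub>DeltaPlus\<^esub> x)"
proof -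
  have C: "x <#\<^bsub>DeltaPlus\<^esub> K \<in> lcosets\<^bsub>DeltaPlus\<^esub> K" using assms by (auto simp: lcosets_iff)
  then show "perm_R M (dart x) = dart (rho \<otimes>\<^bsub>DeltaPlus\<^esub> x)"
    and "perm_L M (dart x) = dart (lam \<otimes>\<^bsub>DeltaPlus\<^esub> x)"
    using iso assms rho_lam unfolding hypermap_iso_def coset_hypermap_simps dart_def
    by (metis (no_types, lifting) P.lcos_m_assoc K.subset lact_def restrict_apply')+
qed

section \<open>Automorphisms are right translations\<close>

text \<open>An automorphism commutes with left multiplication by \<open>rho\<close> and
  \<open>lam\<close>, hence by the whole group they generate. A dart has no preferred
  representative, so commutation is phrased through arbitrary representatives \<open>x\<close> and
  \<open>y\<close> of a dart and its image.\<close>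

lemma automorphism_dart:
  assumes "\<alpha> \<in> hypermap_automorphisms M"
    and "\<alpha> (dart x) = dart y" "x \<in> carrier DeltaPlus" "y \<in> carrier DeltaPlus"
    and g: "g \<in> carrier DeltaPlus"
  shows "\<alpha> (dart (g \<otimes>\<^bsub>DeltaPlus\<^esub> x)) = dart (g \<otimes>\<^bsub>DeltaPlus\<^esub> y)"
proof -
  have base: "\<alpha> (dart (h \<otimes>\<^bsub>DeltaPlus\<^esub> u)) = dart (h \<otimes>\<^bsub>DeltaPlus\<^esub> v)"
    if "h \<in> {rho, lam}" "\<alpha> (dart u) = dart v" "u \<in> carrier DeltaPlus" "v \<in> carrier DeltaPlus" for h u v
  proof -
    have "dart u \<in> darts M" using that by (auto simp: darts_eq)
    with assms(1) that show ?thesis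
      using perm_dart[of u] perm_dart[of v] by (auto simp: hypermap_automorphisms_def)
  qed
  have "g \<in> generate DeltaPlus {rho, lam}" using g generate_DeltaPlus by simp
  then show ?thesis using assms(2-4)
  proof (induction arbitrary: x y rule: generate.induct)
    case one
    then show ?case by simp
  next
    case (incl h)
    then show ?case by (rule base)
  next
    case (inv h)
    then have h: "h \<in> carrier DeltaPlus" using rho_lam by auto
    \<comment> \<open>Commutation is known for \<open>h\<close> only, not yet for its inverse: name
      the image of the dart of h^{-1} x by \<open>z\<close>, apply \<open>h\<close> to it, compare
      with \<open>y\<close>, and cancel \<open>h\<close> on the left.\<close>
    have "dart (inv\<^bsub>DeltaPlus\<^esub> h \<otimes>\<^bsub>DeltaPlus\<^esub> x) \<in> darts M" using inv h by (auto simp: darts_eq)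
    then have "\<alpha> (dart (inv\<^bsub>DeltaPlus\<^esub> h \<otimes>\<^bsub>DeltaPlus\<^esub> x)) \<in> darts M"
      using assms(1) by (auto simp: hypermap_automorphisms_def BijGroup_def Bij_def bij_betw_def)
    then obtain z where z: "z \<in> carrier DeltaPlus"
      and \<alpha>z: "\<alpha> (dart (inv\<^bsub>DeltaPlus\<^esub> h \<otimes>\<^bsub>DeltaPlus\<^esub> x)) = dart z"
      by (auto simp: darts_eq)
    have "\<alpha> (dart (h \<otimes>\<^bsub>DeltaPlus\<^esub> (inv\<^bsub>DeltaPlus\<^esub> h \<otimes>\<^bsub>DeltaPlus\<^esub> x))) = dart (h \<otimes>\<^bsub>DeltaPlus\<^esub> z)"
      using inv h z by (intro base \<alpha>z) auto
    then have "dart y = dart (h \<otimes>\<^bsub>DeltaPlus\<^esub> z)" using inv h by (simp add: P.m_assoc[symmetric])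
    then have "dart (inv\<^bsub>DeltaPlus\<^esub> h \<otimes>\<^bsub>DeltaPlus\<^esub> y)
        = dart (inv\<^bsub>DeltaPlus\<^esub> h \<otimes>\<^bsub>DeltaPlus\<^esub> (h \<otimes>\<^bsub>DeltaPlus\<^esub> z))"
      using inv h z by (intro dart_mult_left_cong) auto
    then show ?case using \<alpha>z h z by (simp add: P.m_assoc[symmetric])
  next
    case (eng h1 h2)
    have "h1 \<in> carrier DeltaPlus" "h2 \<in> carrier DeltaPlus"
      using eng(1,2) generate_DeltaPlus by auto
    then show ?case using eng by (simp add: P.m_assoc)
  qed
qed

text \<open>Inverting the translating element makes this a homomorphism rather than an antihomomorphism.\<close>

definition translation :: "delta \<Rightarrow> 'd \<Rightarrow> 'd" where
  "translation c =
     (\<lambda>d\<in>darts M. dart ((SOME x. x \<in> carrier DeltaPlus \<and> dart x = d) \<otimes>\<^bsub>DeltaPlus\<^esub> inv\<^bsub>DeltaPlus\<^esub> c))"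

text \<open>The representative picked by \<open>SOME\<close> may be replaced by \<open>x\<close>,
  because right multiplication is well defined on darts.\<close>

lemma translation_dart:
  assumes "x \<in> carrier DeltaPlus" "c \<in> carrier DeltaPlus"
  shows "translation c (dart x) = dart (x \<otimes>\<^bsub>DeltaPlus\<^esub> inv\<^bsub>DeltaPlus\<^esub> c)"
proof -
  define z where "z = (SOME z. z \<in> carrier DeltaPlus \<and> dart z = dart x)"
  have "z \<in> carrier DeltaPlus \<and> dart z = dart x"
    unfolding z_def by (rule someI[of _ x]) (simp add: assms)
  then show ?thesis
    using assms by (simp add: translation_def darts_eq z_def[symmetric] dart_mult_right_eq_iff)
qed

lemma translation_extensional: "translation c \<in> extensional (darts M)"
  by (simp add: translation_def)

lemma translation_automorphism:
  assumes c: "c \<in> carrier DeltaPlus"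
  shows "translation c \<in> hypermap_automorphisms M"
proof -
  have "bij_betw (translation c) (darts M) (darts M)"
    by (rule bij_betw_byWitness[where f' = "translation (inv\<^bsub>DeltaPlus\<^esub> c)"])
       (use c in \<open>auto simp: darts_eq translation_dart P.m_assoc\<close>)
  then have "translation c \<in> carrier (BijGroup (darts M))"
    by (simp add: BijGroup_def Bij_def translation_extensional)
  then show ?thesis
    using c rho_lam
    by (auto simp: hypermap_automorphisms_def darts_eq translation_dart perm_dart P.m_assoc)
qed

lemma translation_mult:
  assumes "c \<in> carrier DeltaPlus" "d \<in> carrier DeltaPlus"
  shows "translation (c \<otimes>\<^bsub>DeltaPlus\<^esub> d) = translation c \<otimes>\<^bsub>BijGroup (darts M)\<^esub> translation d"
proof -
  interpret B: group "BijGroup (darts M)" by (rule group_BijGroup)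
  have closed: "translation u \<in> carrier (BijGroup (darts M))" if "u \<in> carrier DeltaPlus" for u
    using translation_automorphism[OF that] by (simp add: hypermap_automorphisms_def)
  show ?thesis
  proof (rule BijGroup_eqI[where S = "darts M"])
    fix d' assume "d' \<in> darts M"
    then obtain x where "x \<in> carrier DeltaPlus" "d' = dart x" by (auto simp: darts_eq)
    then show "translation (c \<otimes>\<^bsub>DeltaPlus\<^esub> d) d'
        = (translation c \<otimes>\<^bsub>BijGroup (darts M)\<^esub> translation d) d'"
      using assms closed
      by (simp add: BijGroup_mult_apply dart_in_darts translation_dart P.inv_mult_group P.m_assoc)
  qed (use assms closed in auto)
qed

text \<open>By transitivity an automorphism is determined by the image of one dart, here that of the
  identity.\<close>

lemma automorphism_is_translation:
  assumes \<alpha>: "\<alpha> \<in> hypermap_automorphisms M"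
  obtains c where "c \<in> carrier DeltaPlus" "\<alpha> = translation c"
proof -
  have "dart \<one>\<^bsub>DeltaPlus\<^esub> \<in> darts M" by (auto simp: darts_eq)
  then have "\<alpha> (dart \<one>\<^bsub>DeltaPlus\<^esub>) \<in> darts M"
    using \<alpha> by (auto simp: hypermap_automorphisms_def BijGroup_def Bij_def bij_betw_def)
  then obtain c where c: "c \<in> carrier DeltaPlus" "\<alpha> (dart \<one>\<^bsub>DeltaPlus\<^esub>) = dart c"
    by (auto simp: darts_eq)
  \<comment> \<open>\<open>translation\<close> multiplies by the inverse of its argument, so right
    multiplication by \<open>c\<close> is the translation by c^{-1}.\<close>
  have "\<alpha> = translation (inv\<^bsub>DeltaPlus\<^esub> c)"
  proof (rule extensionalityI[where A = "darts M"])
    show "\<alpha> \<in> extensional (darts M)"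
      using \<alpha> by (simp add: hypermap_automorphisms_def BijGroup_def Bij_def)
    show "translation (inv\<^bsub>DeltaPlus\<^esub> c) \<in> extensional (darts M)" by (rule translation_extensional)
    fix d assume "d \<in> darts M"
    then obtain x where "x \<in> carrier DeltaPlus" "d = dart x" by (auto simp: darts_eq)
    then show "\<alpha> d = translation (inv\<^bsub>DeltaPlus\<^esub> c) d"
      using automorphism_dart[OF \<alpha> c(2) _ c(1), of x] c by (simp add: translation_dart)
  qed
  with c show thesis by (intro that[of "inv\<^bsub>DeltaPlus\<^esub> c"]) auto
qed

text \<open>Since (x c^{-1})^{-1} x = c, the translation fixes the dart of the identity, and equally
  every other dart, exactly when \<open>c\<close> is in \<open>K\<close>. This gives the kernel for
  the isomorphism theorem.\<close>

lemma translation_eq_one_iff: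
  assumes "c \<in> carrier DeltaPlus"
  shows "translation c = \<one>\<^bsub>BijGroup (darts M)\<^esub> \<longleftrightarrow> c \<in> K"
proof
  assume "translation c = \<one>\<^bsub>BijGroup (darts M)\<^esub>"
  then have "translation c (dart \<one>\<^bsub>DeltaPlus\<^esub>) = dart \<one>\<^bsub>DeltaPlus\<^esub>"
    by (auto simp: BijGroup_def darts_eq)
  then have "dart (inv\<^bsub>DeltaPlus\<^esub> c) = dart \<one>\<^bsub>DeltaPlus\<^esub>" using assms by (simp add: translation_dart)
  then show "c \<in> K" using assms by (simp add: dart_eq_iff)
next
  assume "c \<in> K"
  then have "dart (x \<otimes>\<^bsub>DeltaPlus\<^esub> inv\<^bsub>DeltaPlus\<^esub> c) = dart x" if "x \<in> carrier DeltaPlus" for x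
    using that assms K.inv_op_closed2[of x c]
    by (subst dart_eq_iff) (auto simp: P.inv_mult_group P.m_assoc)
  then show "translation c = \<one>\<^bsub>BijGroup (darts M)\<^esub>"
    using assms
    by (intro extensionalityI[where A = "darts M"])
       (simp_all add: translation_extensional, auto simp: BijGroup_def translation_dart darts_eq)
qed

section \<open>The type read off from powers in the hypermap subgroup\<close>

text \<open>The n-th power of \<open>p\<close> is left multiplication by the n-th power of
  \<open>g\<close>. It fixes the dart of the identity iff that power lies in \<open>K\<close>, and
  then by normality it fixes all darts. Divisibility records the whole set of exponents at
  once.\<close>

lemma ord_dvd_iff_pow_mem:
  assumes p: "p \<in> carrier (BijGroup (darts M))" and g: "g \<in> carrier DeltaPlus"
    and pg: "\<And>x. x \<in> carrier DeltaPlus \<Longrightarrow> p (dart x) = dart (g \<otimes>\<^bsub>DeltaPlus\<^esub> x)"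
  shows "group.ord (BijGroup (darts M)) p dvd n \<longleftrightarrow> g [^]\<^bsub>DeltaPlus\<^esub> n \<in> K"
proof -
  interpret B: group "BijGroup (darts M)" by (rule group_BijGroup)
  let ?p = "\<lambda>n::nat. p [^]\<^bsub>BijGroup (darts M)\<^esub> n"
  \<comment> \<open>The innermost factor of \<open>?p (Suc n)\<close> acts first and replaces
    \<open>x\<close> by \<open>g x\<close>; hence the induction generalises over
    \<open>x\<close>.\<close>
  have pow: "?p n (dart x) = dart (g [^]\<^bsub>DeltaPlus\<^esub> n \<otimes>\<^bsub>DeltaPlus\<^esub> x)" if "x \<in> carrier DeltaPlus" for n x
    using that
  proof (induction n arbitrary: x)
    case 0
    then show ?case by (simp add: BijGroup_one_apply dart_in_darts)
  next
    case (Suc n)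
    have "?p (Suc n) (dart x) = ?p n (p (dart x))"
      using Suc(2) by (simp add: BijGroup_mult_apply[OF B.nat_pow_closed[OF p] p] dart_in_darts)
    then show ?case using Suc g by (simp add: pg P.m_assoc)
  qed
  have "?p n = \<one>\<^bsub>BijGroup (darts M)\<^esub> \<longleftrightarrow> g [^]\<^bsub>DeltaPlus\<^esub> n \<in> K"
  proof
    assume "?p n = \<one>\<^bsub>BijGroup (darts M)\<^esub>"
    then have "?p n (dart \<one>\<^bsub>DeltaPlus\<^esub>) = dart \<one>\<^bsub>DeltaPlus\<^esub>" by (simp add: BijGroup_one_apply dart_in_darts)
    then have "dart \<one>\<^bsub>DeltaPlus\<^esub> = dart (g [^]\<^bsub>DeltaPlus\<^esub> n)" using pow[of "\<one>\<^bsub>DeltaPlus\<^esub>" n] g by simp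
    then show "g [^]\<^bsub>DeltaPlus\<^esub> n \<in> K" using g by (simp add: dart_eq_iff)
  next
    assume *: "g [^]\<^bsub>DeltaPlus\<^esub> n \<in> K"
    have "dart x = dart (g [^]\<^bsub>DeltaPlus\<^esub> n \<otimes>\<^bsub>DeltaPlus\<^esub> x)" if "x \<in> carrier DeltaPlus" for x
      using that g K.inv_op_closed1[OF that *] by (simp add: dart_eq_iff P.m_assoc)
    then have "?p n d = d" if "d \<in> darts M" for d using that pow by (auto simp: darts_eq)
    then show "?p n = \<one>\<^bsub>BijGroup (darts M)\<^esub>"
      by (intro BijGroup_eqI[OF B.nat_pow_closed[OF p] B.one_closed]) (simp add: BijGroup_one_apply)
  qed
  then show ?thesis using B.pow_eq_id[OF p] by simp
qed

text \<open>Each entry of the type is described by its multiples, so that comparing two types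
  reduces to comparing which powers lie in the two subgroups.\<close>

lemma hypermap_type_orders:
  assumes "hypermap M"
  obtains m n k where "hypermap_type M = (m, n, k)"
    and "\<And>i. m dvd i \<longleftrightarrow> (rho \<otimes>\<^bsub>DeltaPlus\<^esub> lam) [^]\<^bsub>DeltaPlus\<^esub> i \<in> K"
    and "\<And>i. n dvd i \<longleftrightarrow> rho [^]\<^bsub>DeltaPlus\<^esub> i \<in> K"
    and "\<And>i. k dvd i \<longleftrightarrow> lam [^]\<^bsub>DeltaPlus\<^esub> i \<in> K"
proof -
  let ?B = "BijGroup (darts M)"
  interpret B: group ?B by (rule group_BijGroup)
  have RL: "perm_R M \<in> carrier ?B" "perm_L M \<in> carrier ?B" using assms by (auto simp: hypermap_def)
  have "(perm_R M \<otimes>\<^bsub>?B\<^esub> perm_L M) (dart x) = dart (rho \<otimes>\<^bsub>DeltaPlus\<^esub> lam \<otimes>\<^bsub>DeltaPlus\<^esub> x)"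
    if "x \<in> carrier DeltaPlus" for x
  proof -
    have "(perm_R M \<otimes>\<^bsub>?B\<^esub> perm_L M) (dart x) = perm_R M (perm_L M (dart x))"
      using RL that by (simp add: BijGroup_mult_apply darts_eq)
    then show ?thesis using that rho_lam by (simp add: perm_dart P.m_assoc)
  qed
  then show thesis
    using RL rho_lam
    by (intro that[of "group.ord ?B (perm_R M \<otimes>\<^bsub>?B\<^esub> perm_L M)" "group.ord ?B (perm_R M)"
          "group.ord ?B (perm_L M)"] ord_dvd_iff_pow_mem)
       (auto simp: hypermap_type_def perm_dart Let_def)
qed

end


section \<open>Coverings of identified hypermaps\<close>

text \<open>In these coordinates the covering is the identity on representatives:
  \<open>f_dart\<close> is the map from xK to xH.\<close>

locale identified_covering =
  M: identified_hypermap K M a + N: identified_hypermap H N b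
  for K :: "delta set" and M :: "'d hypermap" and a and H and N :: "'e hypermap" and b +
  fixes f :: "'d \<Rightarrow> 'e"
  assumes K_subset_H: "K \<subseteq> H"
    and f_dart: "\<And>x. x \<in> carrier DeltaPlus \<Longrightarrow> f (M.dart x) = N.dart x"
begin

sublocale H: group "DeltaPlus\<lparr>carrier := H\<rparr>"
  by (rule N.K.subgroup_is_group[OF P.is_group])

lemma normal_restrict: "K \<lhd> DeltaPlus\<lparr>carrier := H\<rparr>"
  by (rule P.normal_restrict_supergroup[OF N.K.subgroup_axioms M.K.normal_axioms K_subset_H])

text \<open>Every automorphism is a translation, and the translation by \<open>c\<close> preserves
  the fibres of \<open>f\<close> iff \<open>c\<close> is in \<open>H\<close>. So the deck group is
  the image of \<open>H\<close> under \<open>translation\<close>.\<close>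

lemma deck_group_group_hom: "group_hom (DeltaPlus\<lparr>carrier := H\<rparr>) (deck_group M f) M.translation"
  and translation_image: "M.translation ` H = carrier (deck_group M f)"
proof -
  have deck_iff: "M.translation c \<in> carrier (deck_group M f) \<longleftrightarrow> c \<in> H"
    if c: "c \<in> carrier DeltaPlus" for c
  proof -
    have "f (M.translation c (M.dart x)) = f (M.dart x) \<longleftrightarrow> c \<in> H" if x: "x \<in> carrier DeltaPlus" for x
    proof -
      \<comment> \<open>Below, the comparison is between xH and x c^{-1} H, whose quotient c^{-1}
        does not depend on \<open>x\<close>.\<close>
      have "f (M.translation c (M.dart x)) = f (M.dart x)
          \<longleftrightarrow> N.dart x = N.dart (x \<otimes>\<^bsub>DeltaPlus\<^esub> inv\<^bsub>DeltaPlus\<^esub> c)"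
        using c x by (auto simp: M.translation_dart f_dart)
      also have "\<dots> \<longleftrightarrow> inv\<^bsub>DeltaPlus\<^esub> c \<in> H"
        using c x by (simp add: N.dart_eq_iff P.m_assoc[symmetric])
      also have "\<dots> \<longleftrightarrow> c \<in> H"
        using c N.K.m_inv_closed P.inv_inv by metis
      finally show ?thesis .
    qed
    then show ?thesis
      using M.translation_automorphism[OF c] by (auto simp: deck_group_def M.darts_eq)
  qed
  show img: "M.translation ` H = carrier (deck_group M f)"
  proof
    show "M.translation ` H \<subseteq> carrier (deck_group M f)"
      using deck_iff N.K.subset by blast
    show "carrier (deck_group M f) \<subseteq> M.translation ` H"
    proof
      fix \<alpha> assume \<alpha>: "\<alpha> \<in> carrier (deck_group M f)"
      then have "\<alpha> \<in> hypermap_automorphisms M" by (simp add: deck_group_def)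
      then obtain c where "c \<in> carrier DeltaPlus" "\<alpha> = M.translation c"
        by (rule M.automorphism_is_translation)
      with \<alpha> deck_iff show "\<alpha> \<in> M.translation ` H" by blast
    qed
  qed
  have hom: "M.translation \<in> hom (DeltaPlus\<lparr>carrier := H\<rparr>) (BijGroup (darts M))"
    using M.translation_automorphism
    by (intro homI) (auto simp: M.translation_mult hypermap_automorphisms_def)
  \<comment> \<open>That the deck group is a group follows from its being a homomorphic image of
    \<open>H\<close> inside the permutation group.\<close>
  have "subgroup (M.translation ` H) (BijGroup (darts M))"
    using group_hom.img_is_subgroup[of "DeltaPlus\<lparr>carrier := H\<rparr>" "BijGroup (darts M)" M.translation]
      hom group_BijGroup H.is_group by (auto simp: group_hom_def group_hom_axioms_def)
  moreover have deck: "deck_group M f = (BijGroup (darts M))\<lparr>carrier := M.translation ` H\<rparr>"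
    unfolding img by (simp add: deck_group_def)
  ultimately have "group (deck_group M f)"
    using subgroup.subgroup_is_group group_BijGroup by metis
  then show "group_hom (DeltaPlus\<lparr>carrier := H\<rparr>) (deck_group M f) M.translation"
    using hom H.is_group by (auto simp: group_hom_def group_hom_axioms_def deck hom_def)
qed

text \<open>First isomorphism theorem for \<open>translation\<close> restricted to \<open>H\<close>;
  its kernel is \<open>K\<close>, which lies inside \<open>H\<close>.\<close>

lemma covering_group_iso_deck_group: "covering_group K H \<cong> deck_group M f"
proof -
  interpret T: group_hom "DeltaPlus\<lparr>carrier := H\<rparr>" "deck_group M f" M.translation
    by (rule deck_group_group_hom)
  have "kernel (DeltaPlus\<lparr>carrier := H\<rparr>) (deck_group M f) M.translation = K"
    using K_subset_H N.K.subset M.translation_eq_one_iff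
    unfolding kernel_def deck_group_def by auto
  then show ?thesis using T.FactGroup_iso translation_image by (simp add: covering_group_def)
qed

text \<open>The fibre over yH consists of the cosets yhK with \<open>h\<close> in \<open>H\<close>,
  so left multiplication by \<open>y\<close> matches it with the cosets of \<open>K\<close> in
  \<open>H\<close>.\<close>

lemma sheeted_covering_sheets: "sheeted M N f (covering_sheets K H)"
  unfolding sheeted_def
proof
  fix e assume "e \<in> darts N"
  then obtain y where y: "y \<in> carrier DeltaPlus" and e: "e = N.dart y" by (auto simp: N.darts_eq)
  \<comment> \<open>Sheets are counted by right cosets Kh while darts are left cosets; normality of
    \<open>K\<close> identifies Kh with hK.\<close>
  have coset: "a (y <#\<^bsub>DeltaPlus\<^esub> (K #>\<^bsub>DeltaPlus\<^esub> h)) = M.dart (y \<otimes>\<^bsub>DeltaPlus\<^esub> h)" if "h \<in> H" for h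
    using that y M.K.coset_eq by (simp add: M.dart_def P.lcos_m_assoc M.K.subset)
  have rcos: "rcosets\<^bsub>DeltaPlus\<lparr>carrier := H\<rparr>\<^esub> K = (\<lambda>h. K #>\<^bsub>DeltaPlus\<^esub> h) ` H"
    by (auto simp: RCOSETS_def r_coset_def)
  have "bij_betw (\<lambda>C. a (y <#\<^bsub>DeltaPlus\<^esub> C)) (rcosets\<^bsub>DeltaPlus\<lparr>carrier := H\<rparr>\<^esub> K)
      {d \<in> darts M. f d = e}"
    unfolding bij_betw_def
  proof
    show "inj_on (\<lambda>C. a (y <#\<^bsub>DeltaPlus\<^esub> C)) (rcosets\<^bsub>DeltaPlus\<lparr>carrier := H\<rparr>\<^esub> K)"
    proof (rule inj_onI)
      fix C C'
      assume "C \<in> rcosets\<^bsub>DeltaPlus\<lparr>carrier := H\<rparr>\<^esub> K" "C' \<in> rcosets\<^bsub>DeltaPlus\<lparr>carrier := H\<rparr>\<^esub> K"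
        and eq: "a (y <#\<^bsub>DeltaPlus\<^esub> C) = a (y <#\<^bsub>DeltaPlus\<^esub> C')"
      then obtain h h' where h: "h \<in> H" "C = K #>\<^bsub>DeltaPlus\<^esub> h" and h': "h' \<in> H" "C' = K #>\<^bsub>DeltaPlus\<^esub> h'"
        unfolding rcos by blast
      have "M.dart (y \<otimes>\<^bsub>DeltaPlus\<^esub> h) = M.dart (y \<otimes>\<^bsub>DeltaPlus\<^esub> h')"
        using eq unfolding h h' coset[OF h(1)] coset[OF h'(1)] .
      then have "M.dart (inv\<^bsub>DeltaPlus\<^esub> y \<otimes>\<^bsub>DeltaPlus\<^esub> (y \<otimes>\<^bsub>DeltaPlus\<^esub> h))
        = M.dart (inv\<^bsub>DeltaPlus\<^esub> y \<otimes>\<^bsub>DeltaPlus\<^esub> (y \<otimes>\<^bsub>DeltaPlus\<^esub> h'))"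
        by (rule M.dart_mult_left_cong) (use y h h' in auto)
      moreover have "h \<in> carrier DeltaPlus" "h' \<in> carrier DeltaPlus" using h h' N.K.subset by auto
      ultimately have "M.dart h = M.dart h'" using y by (simp add: P.m_assoc[symmetric])
      then have "h <#\<^bsub>DeltaPlus\<^esub> K = h' <#\<^bsub>DeltaPlus\<^esub> K"
        using h h' by (simp add: M.dart_eq_iff M.K.l_coset_eq_iff[OF P.is_group])
      then show "C = C'" using h h' M.K.coset_eq by simp
    qed
    show "(\<lambda>C. a (y <#\<^bsub>DeltaPlus\<^esub> C)) ` (rcosets\<^bsub>DeltaPlus\<lparr>carrier := H\<rparr>\<^esub> K) = {d \<in> darts M. f d = e}"
    proof (intro subset_antisym subsetI)
      fix d assume "d \<in> (\<lambda>C. a (y <#\<^bsub>DeltaPlus\<^esub> C)) ` (rcosets\<^bsub>DeltaPlus\<lparr>carrier := H\<rparr>\<^esub> K)"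
      then obtain h where h: "h \<in> H" "d = M.dart (y \<otimes>\<^bsub>DeltaPlus\<^esub> h)"
        unfolding rcos using coset by auto
      then have "N.dart y = N.dart (y \<otimes>\<^bsub>DeltaPlus\<^esub> h)"
        using y by (simp add: N.dart_eq_iff P.m_assoc[symmetric])
      with h y show "d \<in> {d \<in> darts M. f d = e}" by (auto simp: M.darts_eq f_dart e)
    next
      fix d assume "d \<in> {d \<in> darts M. f d = e}"
      then obtain x where x: "x \<in> carrier DeltaPlus" "d = M.dart x" and "N.dart y = N.dart x"
        by (auto simp: M.darts_eq f_dart e)
      then have h: "inv\<^bsub>DeltaPlus\<^esub> y \<otimes>\<^bsub>DeltaPlus\<^esub> x \<in> H" using y by (simp add: N.dart_eq_iff)
      have "d = M.dart (y \<otimes>\<^bsub>DeltaPlus\<^esub> (inv\<^bsub>DeltaPlus\<^esub> y \<otimes>\<^bsub>DeltaPlus\<^esub> x))"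
        using x y by (simp add: P.m_assoc[symmetric])
      then show "d \<in> (\<lambda>C. a (y <#\<^bsub>DeltaPlus\<^esub> C)) ` (rcosets\<^bsub>DeltaPlus\<lparr>carrier := H\<rparr>\<^esub> K)"
        unfolding rcos using coset[OF h] h by (metis imageI)
    qed
  qed
  then show "card {d \<in> darts M. f d = e} = covering_sheets K H"
    unfolding covering_sheets_def by (rule bij_betw_same_card[symmetric])
qed

end

section \<open>Coverings independently of the chosen identifications\<close>

lemma covering_sheets_eq_order: "covering_sheets K H = order (covering_group K H)"
  by (simp add: covering_sheets_def covering_group_def order_def FactGroup_def)

lemma covering_exists:
  assumes "hypermap_subgroup M K" "hypermap_subgroup N H" "K \<subseteq> H"
  shows "\<exists>f. covering M K N H f"
proof -
  obtain a b where a: "hypermap_iso (coset_hypermap K) M a" and b: "hypermap_iso (coset_hypermap H) N b"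
    and norm: "K \<lhd> DeltaPlus" "H \<lhd> DeltaPlus"
    using assms(1,2) by (auto simp: hypermap_subgroup_def)
  interpret M: identified_hypermap K M a
    using norm a by (simp add: identified_hypermap_def identified_hypermap_axioms_def)
  interpret N: identified_hypermap H N b
    using norm b by (simp add: identified_hypermap_def identified_hypermap_axioms_def)
  \<comment> \<open>Any representative of \<open>d\<close> will do: two of them differ by an element
    of \<open>K\<close>, hence of \<open>H\<close>, and so give the same dart of
    \<open>N\<close>.\<close>
  define f where "f d = N.dart (SOME x. x \<in> carrier DeltaPlus \<and> M.dart x = d)" for d
  have "f (M.dart x) = N.dart x" if x: "x \<in> carrier DeltaPlus" for x
  proof -
    define z where "z = (SOME z. z \<in> carrier DeltaPlus \<and> M.dart z = M.dart x)"
    have z: "z \<in> carrier DeltaPlus \<and> M.dart z = M.dart x"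
      unfolding z_def by (rule someI[of _ x]) (simp add: x)
    then have "N.dart z = N.dart x" using x assms(3) by (auto simp: M.dart_eq_iff N.dart_eq_iff)
    then show ?thesis by (simp add: f_def z_def)
  qed
  then show ?thesis
    using a b norm assms(3) unfolding covering_def M.dart_def N.dart_def by blast
qed

text \<open>The conclusions do not mention the identifications hidden in \<open>covering\<close>;
  the proof unpacks them once and transfers the results of the locale.\<close>

lemma covering_properties:
  assumes "covering M K N H f"
  shows "regular_covering M K N H f"
    and "sheeted M N f (order (covering_group K H))"
    and "covering_group K H \<cong> deck_group M f"
    and "group (covering_group K H)"
proof -
  obtain a b where a: "hypermap_iso (coset_hypermap K) M a" and b: "hypermap_iso (coset_hypermap H) N b"
    and norm: "K \<lhd> DeltaPlus" "H \<lhd> DeltaPlus" and sub: "K \<subseteq> H"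
    and f: "\<And>x. x \<in> carrier DeltaPlus \<Longrightarrow> f (a (x <#\<^bsub>DeltaPlus\<^esub> K)) = b (x <#\<^bsub>DeltaPlus\<^esub> H)"
    using assms by (auto simp: covering_def)
  interpret M: identified_hypermap K M a
    using norm a by (simp add: identified_hypermap_def identified_hypermap_axioms_def)
  interpret N: identified_hypermap H N b
    using norm b by (simp add: identified_hypermap_def identified_hypermap_axioms_def)
  interpret identified_covering K M a H N b f
    by unfold_locales (use sub f in \<open>auto simp: M.dart_def N.dart_def\<close>)
  show "regular_covering M K N H f" using assms normal_restrict by (simp add: regular_covering_def)
  show "sheeted M N f (order (covering_group K H))"
    using sheeted_covering_sheets by (simp add: covering_sheets_eq_order)
  show "covering_group K H \<cong> deck_group M f" by (rule covering_group_iso_deck_group)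
  show "group (covering_group K H)"
    unfolding covering_group_def by (rule normal.factorgroup_is_group[OF normal_restrict])
qed


section \<open>Reflection\<close>

text \<open>The factor \<open>gen L2\<close> is odd, so the product is formed in
  \<open>Delta\<close>, although the conjugation preserves \<open>DeltaPlus\<close>.\<close>

definition reflect :: "delta \<Rightarrow> delta" where
  "reflect x = gen L2 \<otimes>\<^bsub>Delta\<^esub> x \<otimes>\<^bsub>Delta\<^esub> gen L2"

lemma mirror_eq_image: "mirror H = reflect ` H"
  by (simp add: mirror_def reflect_def)

lemma mult_DeltaPlus: "monoid.mult DeltaPlus = monoid.mult Delta"
  and one_DeltaPlus: "\<one>\<^bsub>DeltaPlus\<^esub> = \<one>\<^bsub>Delta\<^esub>"
  by (simp_all add: DeltaPlus_def)

interpretation D: group Delta by (rule group_Delta)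

lemma gen_mult_gen_mult: "gen l \<otimes>\<^bsub>Delta\<^esub> (gen l \<otimes>\<^bsub>Delta\<^esub> x) = x"
  by (simp add: D.m_assoc[symmetric] carrier_Delta gen_gen)

lemmas Delta_simps = carrier_Delta D.m_assoc gen_gen gen_mult_gen_mult

lemma reflect_reflect: "reflect (reflect x) = x"
  by (simp add: reflect_def Delta_simps)

text \<open>Because \<open>reflect\<close> is an involution, the image of \<open>H\<close> is also
  its preimage.\<close>

lemma in_mirror_iff: "x \<in> mirror H \<longleftrightarrow> reflect x \<in> H"
  unfolding mirror_eq_image by (metis image_iff reflect_reflect)

lemma reflect_group_hom: "group_hom DeltaPlus DeltaPlus reflect"
proof
  show "reflect \<in> hom DeltaPlus DeltaPlus"
    by (rule homI)
       (auto simp: DeltaPlus_def reflect_def even_mult even_gen Delta_simps)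
qed

interpretation reflect: group_hom DeltaPlus DeltaPlus reflect
  by (rule reflect_group_hom)

text \<open>Each generator is a product of \<open>gen L2\<close> with another involution;
  conjugating by \<open>gen L2\<close> swaps the two factors, which inverts the product.\<close>

lemma reflect_generators:
  "reflect rho = inv\<^bsub>DeltaPlus\<^esub> rho" "reflect lam = inv\<^bsub>DeltaPlus\<^esub> lam"
proof -
  have *: "reflect x = inv\<^bsub>DeltaPlus\<^esub> x" if "reflect x \<otimes>\<^bsub>Delta\<^esub> x = \<one>\<^bsub>Delta\<^esub>" "x \<in> carrier DeltaPlus" for x
    using that by (intro P.inv_equality[symmetric]) (simp_all add: mult_DeltaPlus one_DeltaPlus)
  show "reflect rho = inv\<^bsub>DeltaPlus\<^esub> rho"
    by (rule *, simp add: reflect_def rho_def lam_def Delta_simps, simp add: rho_lam)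
  show "reflect lam = inv\<^bsub>DeltaPlus\<^esub> lam"
    by (rule *, simp add: reflect_def rho_def lam_def Delta_simps, simp add: rho_lam)
qed

section \<open>Smoothness of the lower covering\<close>

text \<open>Reflecting a power of \<open>g\<close> gives a conjugate of the inverse of that power,
  and membership in the normal subgroup \<open>H\<close> ignores both conjugation and inversion. The
  conjugator \<open>t\<close> is there for the product of \<open>rho\<close> and \<open>lam\<close>,
  which is not simply inverted.\<close>

lemma pow_in_mirror_iff:
  assumes H: "H \<lhd> DeltaPlus" and g: "g \<in> carrier DeltaPlus" and t: "t \<in> carrier DeltaPlus"
    and "reflect g = inv\<^bsub>DeltaPlus\<^esub> t \<otimes>\<^bsub>DeltaPlus\<^esub> inv\<^bsub>DeltaPlus\<^esub> g \<otimes>\<^bsub>DeltaPlus\<^esub> t"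
  shows "g [^]\<^bsub>DeltaPlus\<^esub> (n::nat) \<in> mirror H \<longleftrightarrow> g [^]\<^bsub>DeltaPlus\<^esub> n \<in> H"
proof -
  interpret H: normal H DeltaPlus by (rule H)
  let ?g = "g [^]\<^bsub>DeltaPlus\<^esub> n"
  have "reflect g [^]\<^bsub>DeltaPlus\<^esub> n = inv\<^bsub>DeltaPlus\<^esub> t \<otimes>\<^bsub>DeltaPlus\<^esub> inv\<^bsub>DeltaPlus\<^esub> ?g \<otimes>\<^bsub>DeltaPlus\<^esub> t"
  proof (induction n)
    case 0
    then show ?case using t by simp
  next
    case (Suc n)
    \<comment> \<open>Splitting \<open>g\<close> off on the left puts its inverse on the right after
      inversion, where the new factor \<open>reflect g\<close> contributes it.\<close>
    have "g [^]\<^bsub>DeltaPlus\<^esub> Suc n = g \<otimes>\<^bsub>DeltaPlus\<^esub> g [^]\<^bsub>DeltaPlus\<^esub> n"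
      using g by (rule P.nat_pow_Suc2)
    then show ?case
      using g t Suc assms(4) by (simp add: P.inv_mult_group P.m_assoc) (simp add: P.m_assoc[symmetric])
  qed
  then have "reflect ?g \<in> H \<longleftrightarrow> inv\<^bsub>DeltaPlus\<^esub> ?g \<in> H"
    using g by (simp add: reflect.hom_nat_pow H.conj_mem_iff t)
  also have "\<dots> \<longleftrightarrow> ?g \<in> H" using g H.m_inv_closed P.inv_inv by (metis P.nat_pow_closed)
  finally show ?thesis by (simp add: in_mirror_iff)
qed

lemma covering_mirror_core_smooth:
  assumes cov: "covering M (H \<inter> mirror H) N H f" and "hypermap M" "hypermap N"
  shows "smooth_covering M (H \<inter> mirror H) N H f"
proof -
  obtain a b where a: "hypermap_iso (coset_hypermap (H \<inter> mirror H)) M a"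
    and b: "hypermap_iso (coset_hypermap H) N b"
    and norm: "H \<inter> mirror H \<lhd> DeltaPlus" "H \<lhd> DeltaPlus"
    using cov by (auto simp: covering_def)
  interpret M: identified_hypermap "H \<inter> mirror H" M a
    using norm a by (simp add: identified_hypermap_def identified_hypermap_axioms_def)
  interpret N: identified_hypermap H N b
    using norm b by (simp add: identified_hypermap_def identified_hypermap_axioms_def)
  \<comment> \<open>The reflection is rho^{-1} lam^{-1}, which is (rho lam)^{-1} = lam^{-1} rho^{-1}
    conjugated by \<open>rho\<close>; for \<open>rho\<close> and \<open>lam\<close> themselves the
    conjugator below is the identity.\<close>
  have "reflect (rho \<otimes>\<^bsub>DeltaPlus\<^esub> lam) = inv\<^bsub>DeltaPlus\<^esub> rho
      \<otimes>\<^bsub>DeltaPlus\<^esub> inv\<^bsub>DeltaPlus\<^esub> (rho \<otimes>\<^bsub>DeltaPlus\<^esub> lam) \<otimes>\<^bsub>DeltaPlus\<^esub> rho"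
    using rho_lam by (simp add: reflect_generators P.inv_mult_group P.m_assoc)
  then have pow: "(rho \<otimes>\<^bsub>DeltaPlus\<^esub> lam) [^]\<^bsub>DeltaPlus\<^esub> i \<in> H \<inter> mirror H
        \<longleftrightarrow> (rho \<otimes>\<^bsub>DeltaPlus\<^esub> lam) [^]\<^bsub>DeltaPlus\<^esub> i \<in> H"
    "rho [^]\<^bsub>DeltaPlus\<^esub> i \<in> H \<inter> mirror H \<longleftrightarrow> rho [^]\<^bsub>DeltaPlus\<^esub> i \<in> H"
    "lam [^]\<^bsub>DeltaPlus\<^esub> i \<in> H \<inter> mirror H \<longleftrightarrow> lam [^]\<^bsub>DeltaPlus\<^esub> i \<in> H" for i :: nat
    using pow_in_mirror_iff[OF norm(2), of "rho \<otimes>\<^bsub>DeltaPlus\<^esub> lam" rho i]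
      pow_in_mirror_iff[OF norm(2), of rho "\<one>\<^bsub>DeltaPlus\<^esub>" i]
      pow_in_mirror_iff[OF norm(2), of lam "\<one>\<^bsub>DeltaPlus\<^esub>" i] rho_lam
    by (auto simp: reflect_generators)
  obtain m n k where M: "hypermap_type M = (m, n, k)"
    "\<And>i. m dvd i \<longleftrightarrow> (rho \<otimes>\<^bsub>DeltaPlus\<^esub> lam) [^]\<^bsub>DeltaPlus\<^esub> i \<in> H \<inter> mirror H"
    "\<And>i. n dvd i \<longleftrightarrow> rho [^]\<^bsub>DeltaPlus\<^esub> i \<in> H \<inter> mirror H"
    "\<And>i. k dvd i \<longleftrightarrow> lam [^]\<^bsub>DeltaPlus\<^esub> i \<in> H \<inter> mirror H"
    by (rule M.hypermap_type_orders[OF assms(2)]) blast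
  obtain m' n' k' where N: "hypermap_type N = (m', n', k')"
    "\<And>i. m' dvd i \<longleftrightarrow> (rho \<otimes>\<^bsub>DeltaPlus\<^esub> lam) [^]\<^bsub>DeltaPlus\<^esub> i \<in> H"
    "\<And>i. n' dvd i \<longleftrightarrow> rho [^]\<^bsub>DeltaPlus\<^esub> i \<in> H"
    "\<And>i. k' dvd i \<longleftrightarrow> lam [^]\<^bsub>DeltaPlus\<^esub> i \<in> H"
    by (rule N.hypermap_type_orders[OF assms(3)]) blast
  have "m dvd i \<longleftrightarrow> m' dvd i" "n dvd i \<longleftrightarrow> n' dvd i" "k dvd i \<longleftrightarrow> k' dvd i" for i
    unfolding M N by (rule pow)+
  \<comment> \<open>Numbers with the same multiples divide each other.\<close>
  then have "m = m'" "n = n'" "k = k'"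
    by (metis dvd_antisym dvd_refl)+
  then show ?thesis using cov M(1) N(1) by (simp add: smooth_covering_def)
qed

section \<open>The chirality group as a quotient of \<open>H\<close>\<close>

text \<open>The second isomorphism theorem presents the chirality group as a quotient of
  \<open>mirror H\<close> rather than of \<open>H\<close>. Precomposing with \<open>reflect\<close>,
  which carries \<open>H\<close> onto \<open>mirror H\<close> and preserves their intersection,
  moves the quotient to \<open>H\<close>.\<close>

lemma covering_group_core_iso_chirality_group:
  assumes H: "H \<lhd> DeltaPlus"
  shows "covering_group (H \<inter> mirror H) H \<cong> chirality_group H"
proof -
  interpret second_isomorphism_grp H DeltaPlus "mirror H"
    using H mirror_normal[OF H] by (simp add: second_isomorphism_grp_def
        second_isomorphism_grp_axioms_def normal_imp_subgroup)
  let ?S = "DeltaPlus\<lparr>carrier := mirror H\<rparr>"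
  let ?H = "DeltaPlus\<lparr>carrier := H\<rparr>"
  let ?q = "\<lambda>g. H #>\<^bsub>DeltaPlus\<^esub> g"
  have mirror: "group_hom ?S (chirality_group H) ?q"
    unfolding chirality_group_def by (rule normal_intersection_hom)
  have "reflect \<in> hom ?H ?S" 
    by (rule homI) (auto simp: mirror_eq_image)
  then have "(?q \<circ> reflect) \<in> hom ?H (chirality_group H)"
    by (rule hom_compose[OF _ group_hom.homh[OF mirror]])
  then interpret q: group_hom ?H "chirality_group H" "?q \<circ> reflect"
    using mirror subgroup_is_group[OF P.is_group]
    by (simp add: group_hom_def group_hom_axioms_def)
  have "H #>\<^bsub>DeltaPlus\<^esub> reflect h = H \<longleftrightarrow> reflect h \<in> H" if "h \<in> H" for h
  proof -
    have "reflect h \<in> carrier DeltaPlus" using that by simp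
    then show ?thesis using P.coset_join1 P.coset_join2 subset is_subgroup by metis
  qed
  then have ker: "kernel ?H (chirality_group H) (?q \<circ> reflect) = H \<inter> mirror H"
    unfolding kernel_def chirality_group_def by (simp add: in_mirror_iff Int_def cong: conj_cong)
  \<comment> \<open>Every coset of \<open>H\<close> in the product has a representative in
    \<open>mirror H\<close>, and \<open>mirror H\<close> is the image of \<open>H\<close> under
    \<open>reflect\<close>.\<close>
  have "(?q \<circ> reflect) ` carrier ?H = carrier (chirality_group H)"
    using normal_intersection_hom_surj by (simp add: chirality_group_def image_image mirror_eq_image)
  from q.FactGroup_iso[OF this] show ?thesis by (simp add: ker covering_group_def)
qed


text \<open>A covering depends on the identifications chosen, so the claims are made for every
  covering map, and existence is asserted separately to exclude a vacuous reading.\<close>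

theorem theorem3:
  fixes M :: "'a hypermap" and M_low :: "'b hypermap" and M_up :: "'c hypermap"
    and H H_low H_up :: "delta set" and \<kappa> :: nat
  assumes "orientably_regular M" and "hypermap_subgroup M H"
    and "\<kappa> = chirality_index H"
    and "H_low = H \<inter> mirror H" and "H_up = H <#>\<^bsub>DeltaPlus\<^esub> mirror H"
    and "orientably_regular M_low" and "hypermap_subgroup M_low H_low"
    and "orientably_regular M_up" and "hypermap_subgroup M_up H_up"
  shows "(\<exists>f. covering M_low H_low M H f) \<and>
    (\<exists>f. covering M H M_up H_up f) \<and>
    (\<forall>f. covering M_low H_low M H f \<longrightarrow>
       regular_covering M_low H_low M H f \<and>
       covering_sheets H_low H = \<kappa> \<and> sheeted M_low M f \<kappa> \<and>
       covering_group H_low H \<cong> chirality_group H \<and>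
       deck_group M_low f \<cong> chirality_group H \<and>
       smooth_covering M_low H_low M H f) \<and>
    (\<forall>f. covering M H M_up H_up f \<longrightarrow>
       regular_covering M H M_up H_up f \<and>
       covering_sheets H H_up = \<kappa> \<and> sheeted M M_up f \<kappa> \<and>
       covering_group H H_up \<cong> chirality_group H \<and>
       deck_group M f \<cong> chirality_group H)"
proof -
  have H: "H \<lhd> DeltaPlus" using assms(2) by (simp add: hypermap_subgroup_def)
  have maps: "hypermap M" "hypermap M_low" using assms by (auto simp: orientably_regular_def)
  interpret second_isomorphism_grp H DeltaPlus "mirror H"
    using H mirror_normal[OF H] by (simp add: second_isomorphism_grp_def
        second_isomorphism_grp_axioms_def normal_imp_subgroup)
  have sub: "H_low \<subseteq> H" "H \<subseteq> H_up" using assms H_contained_in_set_mult by auto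
  have low: "covering_group H_low H \<cong> chirality_group H"
    using covering_group_core_iso_chirality_group[OF H] assms by simp
  \<comment> \<open>For the upper covering the two groups coincide by definition, so equality holds
    and not only isomorphism.\<close>
  have up: "covering_group H H_up = chirality_group H"
    using assms by (simp add: covering_group_def chirality_group_def)
  have orders: "order (covering_group H_low H) = \<kappa>" "order (covering_group H H_up) = \<kappa>"
    using iso_same_card[OF low] up assms by (simp_all add: order_def chirality_index_def)
  have deck_low: "deck_group M_low f \<cong> chirality_group H" if "covering M_low H_low M H f" for f
    using covering_properties(3,4)[OF that] low group.iso_sym iso_trans by blast
  have deck_up: "deck_group M f \<cong> chirality_group H" if "covering M H M_up H_up f" for f
    using covering_properties(3,4)[OF that] group.iso_sym up by metis
  have smooth: "smooth_covering M_low H_low M H f" if "covering M_low H_low M H f" for f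
    using covering_mirror_core_smooth that maps assms by blast
  have low_all: "regular_covering M_low H_low M H f \<and>
       covering_sheets H_low H = \<kappa> \<and> sheeted M_low M f \<kappa> \<and>
       covering_group H_low H \<cong> chirality_group H \<and>
       deck_group M_low f \<cong> chirality_group H \<and>
       smooth_covering M_low H_low M H f" if "covering M_low H_low M H f" for f
    using covering_properties(1,2)[OF that] low deck_low[OF that] smooth[OF that]
    by (simp add: covering_sheets_eq_order orders)
  have up_all: "regular_covering M H M_up H_up f \<and>
       covering_sheets H H_up = \<kappa> \<and> sheeted M M_up f \<kappa> \<and>
       covering_group H H_up \<cong> chirality_group H \<and>
       deck_group M f \<cong> chirality_group H" if "covering M H M_up H_up f" for f
    using covering_properties(1,2)[OF that] deck_up[OF that]
    by (simp add: covering_sheets_eq_order orders[simplified up] up iso_refl)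
  show ?thesis
    by (rule conjI[OF covering_exists[OF assms(7,2) sub(1)]
          conjI[OF covering_exists[OF assms(2,9) sub(2)]
            conjI[OF allI[OF impI[OF low_all]] allI[OF impI[OF up_all]]]]])
qed

end
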